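(* Let $n\ge1$, $0\le k\le n$, $s=\min(k,n-k)$ and $H\subseteq\{0,\dots,s\}$. Assume that the matrices $[B_{i-1}]_{B_i}$ for $i=2,3,\dots,n$ have been computed. Given a column vector $[f]_{B_0}$ with $f\in\mathcal F$, the column vector $[f_H]_{B_0}$ can be computed using at most $4(n-1)\binom nk$ operations.
   Context: Let $X$ be the set of words $w_1\dots w_n$ in the alphabet $\{1,2\}$ with exactly $k$ letters $1$ (the word corresponds to the $k$-subset $\{j: w_j=1\}$ of $\{1,\dots,n\}$). The symmetric group $S_n$ acts on $X$ via its action on $k$-subsets. $\mathcal F$ is the space of complex functions on $X$, with $\sigma f=f\circ\sigma^{-1}$ and the inner product for which the delta functions $\delta(x)$, $x\in X$, are orthonormal. For $i\le n$, $S_i\subset S_n$ is the subgroup fixing $i+1,\dots,n$; irreducible representations of $S_i$ are indexed by Young diagrams with $i$ boxes in the usual way ($(i)$ is the trivial representation), and $\mathcal F_{i,\lambda}$ is the $\lambda$-isotypic component of $\mathcal F$ as an $S_i$-module. Write $\lambda\nearrow\mu$ if $\mu$ is obtained from $\lambda$ by adding one box. For Young diagrams $\lambda_1,\dots,\lambda_p$ with $\lambda_j$ having $j$ boxes, $\mathcal F_{\lambda_1\dots\lambda_p}=\mathcal F_{1,\lambda_1}\cap\dots\cap\mathcal F_{p,\lambda_p}$. For a word $c_q\dots c_n$ in $\{1,2\}$, $\mathcal F^{c_q\dots c_n}$ is the span of the $\delta(w)$ with $w\in X$, $w_q\dots w_n=c_q\dots c_n$; for $q=n+1$ (empty word) it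 is $\mathcal F$. Put $\mathcal F_{\lambda_1\dots\lambda_p}^{c_q\dots c_n}=\mathcal F_{\lambda_1\dots\lambda_p}\cap\mathcal F^{c_q\dots c_n}$ (for $p=0$ this means $\mathcal F^{c_q\dots c_n}$). For $0\le i\le n$, $\mathcal F$ is the orthogonal direct sum of the one-dimensional subspaces $\mathcal F_{\lambda_1\dots\lambda_i}^{c_{i+1}\dots c_n}$, over all words $c_{i+1}\dots c_n$ with exactly $k-r$ letters $1$ for some $0\le r\le k$, and all chains $\lambda_1\nearrow\dots\nearrow\lambda_i$ with $\lambda_i=(i-a,a)$, $0\le a\le\min(r,i-r)$. The $i$-th intermediate basis $B_i$ is obtained by choosing one unit vector, with real values, in each of these subspaces. For $i=0$ the unit vectors are taken to be the delta functions, and $B_1$ is normalized so that $B_1=B_0$. Thus the change of basis matrices are orthogonal and $[B_i]_{B_{i-1}}$ is the transpose of $[B_{i-1}]_{B_i}$. $[B]_{B'}$ denotes the change of basis matrix, whose columns are the elements of $B$ written in the basis $B'$, and $[f]_B$ is the coordinate column vector of $f$ in $B$. For $a=0,\dots,s$, $\mathcal F_a=\mathcal F_{n,(n-a,a)}$; one has $\mathcal F=\bigoplus_{a=0}^s\mathcal F_a$ orthogonally, and $f=\sum_{a=0}^s f_a$ with $f_a\in\mathcal F_a$. For $H\subseteq\{0,\dots,s\}$, $f_H=\sum_{a\in H}f_a$. Computational model: a single complex multiplication and addition counts as one operation. Only these algebraic operations are counted; operations involved in storage (for example reordering rows and columns of a matrix, or transposing) are not counted. *)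

theory Defs
  imports Complex_Main "HOL-Library.Function_Algebras" "HOL-Library.Sublist"
    "HOL-Combinatorics.Permutations"
begin

text \<open>
  Positions of words, and the points moved by permutations, are numbered from 0:
  position \<open>j\<close> here is position \<open>j + 1\<close> in the usual numbering, and the subgroup \<open>S\<^sub>i\<close> consists of
  the \<open>\<sigma>\<close> with \<open>\<sigma> permutes {..<i}\<close>.
\<close>

section \<open>Complex-valued functions as a vector space\<close>

definition fscale :: "complex \<Rightarrow> ('a \<Rightarrow> complex) \<Rightarrow> 'a \<Rightarrow> complex"
  where "fscale c f = (\<lambda>x. c * f x)"

global_interpretation cfun: vector_space "fscale :: complex \<Rightarrow> ('a \<Rightarrow> complex) \<Rightarrow> 'a \<Rightarrow> complex"
  by unfold_locales (auto simp: fscale_def fun_eq_iff algebra_simps)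

definition delta :: "'a \<Rightarrow> 'a \<Rightarrow> complex"
  where "delta x = (\<lambda>y. if y = x then 1 else 0)"

section \<open>The permutation module on words\<close>

definition words :: "nat \<Rightarrow> nat \<Rightarrow> nat list set"
  where "words n k = {w. length w = n \<and> set w \<subseteq> {1, 2} \<and> count_list w 1 = k}"

text \<open>Functions on \<open>words n k\<close> are represented by functions on all lists vanishing off \<open>words n k\<close>.\<close>

definition wfuns :: "nat \<Rightarrow> nat \<Rightarrow> (nat list \<Rightarrow> complex) set"
  where "wfuns n k = {f. \<forall>w. w \<notin> words n k \<longrightarrow> f w = 0}"

definition winner :: "nat \<Rightarrow> nat \<Rightarrow> (nat list \<Rightarrow> complex) \<Rightarrow> (nat list \<Rightarrow> complex) \<Rightarrow> complex"
  where "winner n k f g = (\<Sum>w\<in>words n k. f w * cnj (g w))"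

text \<open>
  The \<open>m\<close>-th letter of \<open>\<sigma> w\<close> is the letter of \<open>w\<close> at position \<open>\<sigma>\<^sup>-\<^sup>1 m\<close>, so the set of positions of
  the letter 1 in \<open>\<sigma> w\<close> is the image under \<open>\<sigma>\<close> of that set for \<open>w\<close>.
\<close>

definition word_act :: "(nat \<Rightarrow> nat) \<Rightarrow> nat list \<Rightarrow> nat list"
  where "word_act \<sigma> w = permute_list (inv \<sigma>) w"

definition wfun_act :: "(nat \<Rightarrow> nat) \<Rightarrow> (nat list \<Rightarrow> complex) \<Rightarrow> nat list \<Rightarrow> complex"
  where "wfun_act \<sigma> f = (\<lambda>w. f (word_act (inv \<sigma>) w))"

section \<open>Young diagrams and Specht modules\<close>

text \<open>A Young diagram is the set of its boxes, each given as (row, column), both counted from 0.\<close>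

definition young_diagrams :: "nat \<Rightarrow> (nat \<times> nat) set set"
  where "young_diagrams i =
    {D. finite D \<and> card D = i \<and> (\<forall>(r, c)\<in>D. \<forall>r'\<le>r. \<forall>c'\<le>c. (r', c') \<in> D)}"

definition add_box :: "(nat \<times> nat) set \<Rightarrow> (nat \<times> nat) set \<Rightarrow> bool"
  where "add_box D E \<longleftrightarrow> (\<exists>b. b \<notin> D \<and> E = insert b D)"

text \<open>The diagram \<open>(i - a, a)\<close>, used for \<open>2 * a \<le> i\<close>.\<close>

definition two_row :: "nat \<Rightarrow> nat \<Rightarrow> (nat \<times> nat) set"
  where "two_row i a = {0} \<times> {..<i - a} \<union> {1} \<times> {..<a}"

definition tableau :: "nat \<Rightarrow> (nat \<times> nat) set \<Rightarrow> (nat \<times> nat \<Rightarrow> nat) \<Rightarrow> bool"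
  where "tableau i D T \<longleftrightarrow> bij_betw T D {..<i}"

definition row_group :: "nat \<Rightarrow> (nat \<times> nat) set \<Rightarrow> (nat \<times> nat \<Rightarrow> nat) \<Rightarrow> (nat \<Rightarrow> nat) set"
  where "row_group i D T =
    {p. p permutes {..<i} \<and> (\<forall>b\<in>D. \<exists>b'\<in>D. fst b' = fst b \<and> p (T b) = T b')}"

definition col_group :: "nat \<Rightarrow> (nat \<times> nat) set \<Rightarrow> (nat \<times> nat \<Rightarrow> nat) \<Rightarrow> (nat \<Rightarrow> nat) set"
  where "col_group i D T =
    {q. q permutes {..<i} \<and> (\<forall>b\<in>D. \<exists>b'\<in>D. snd b' = snd b \<and> q (T b) = T b')}"

text \<open>
  The group algebra of \<open>S\<^sub>i\<close> is realized as the functions on permutations supported on \<open>S\<^sub>i\<close>.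
  The Young symmetrizer is the product of the sum of the row group and the signed sum of the
  column group; the left ideal it generates is the Specht module. With this convention the
  one-row diagram gives the trivial representation.
\<close>

definition young_symmetrizer ::
    "nat \<Rightarrow> (nat \<times> nat) set \<Rightarrow> (nat \<times> nat \<Rightarrow> nat) \<Rightarrow> (nat \<Rightarrow> nat) \<Rightarrow> complex"
  where "young_symmetrizer i D T =
    (\<lambda>\<tau>. \<Sum>(p, q) | p \<in> row_group i D T \<and> q \<in> col_group i D T \<and> p \<circ> q = \<tau>. of_int (sign q))"

definition left_mult :: "(nat \<Rightarrow> nat) \<Rightarrow> ((nat \<Rightarrow> nat) \<Rightarrow> complex) \<Rightarrow> (nat \<Rightarrow> nat) \<Rightarrow> complex"
  where "left_mult \<sigma> v = (\<lambda>\<tau>. v (inv \<sigma> \<circ> \<tau>))"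

definition specht ::
    "nat \<Rightarrow> (nat \<times> nat) set \<Rightarrow> (nat \<times> nat \<Rightarrow> nat) \<Rightarrow> ((nat \<Rightarrow> nat) \<Rightarrow> complex) set"
  where "specht i D T =
    cfun.span {left_mult \<sigma> (young_symmetrizer i D T) | \<sigma>. \<sigma> permutes {..<i}}"

definition rep_iso ::
    "nat \<Rightarrow> ((nat \<Rightarrow> nat) \<Rightarrow> ('a \<Rightarrow> complex) \<Rightarrow> 'a \<Rightarrow> complex) \<Rightarrow> ('a \<Rightarrow> complex) set \<Rightarrow>
      ((nat \<Rightarrow> nat) \<Rightarrow> ('b \<Rightarrow> complex) \<Rightarrow> 'b \<Rightarrow> complex) \<Rightarrow> ('b \<Rightarrow> complex) set \<Rightarrow> bool"
  where "rep_iso i actV V actW W \<longleftrightarrow>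
    (\<exists>\<phi>. bij_betw \<phi> V W \<and>
      (\<forall>x\<in>V. \<forall>y\<in>V. \<phi> (x + y) = \<phi> x + \<phi> y) \<and>
      (\<forall>c. \<forall>x\<in>V. \<phi> (fscale c x) = fscale c (\<phi> x)) \<and>
      (\<forall>\<sigma>. \<sigma> permutes {..<i} \<longrightarrow> (\<forall>x\<in>V. \<phi> (actV \<sigma> x) = actW \<sigma> (\<phi> x))))"

text \<open>
  The isotypic component is the sum of all submodules isomorphic to the Specht module; the
  isomorphism class of the latter does not depend on the tableau.
\<close>

definition isotypic :: "nat \<Rightarrow> nat \<Rightarrow> nat \<Rightarrow> (nat \<times> nat) set \<Rightarrow> (nat list \<Rightarrow> complex) set"
  where "isotypic n k i D =
    cfun.span (\<Union> {W. W \<subseteq> wfuns n k \<and> cfun.subspace W \<and>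
      (\<forall>\<sigma>. \<sigma> permutes {..<i} \<longrightarrow> wfun_act \<sigma> ` W \<subseteq> W) \<and>
      (\<exists>T. tableau i D T \<and> rep_iso i left_mult (specht i D T) wfun_act W)})"

section \<open>Intermediate bases\<close>

text \<open>A chain \<open>\<lambda>\<^sub>1 \<nearrow> \<dots> \<nearrow> \<lambda>\<^sub>i\<close> is a list whose entry at index \<open>j\<close> is \<open>\<lambda>\<close> with subscript \<open>j + 1\<close>.\<close>

definition young_chain :: "(nat \<times> nat) set list \<Rightarrow> bool"
  where "young_chain L \<longleftrightarrow>
    (\<forall>j<length L. L ! j \<in> young_diagrams (Suc j)) \<and>
    (\<forall>j. Suc j < length L \<longrightarrow> add_box (L ! j) (L ! Suc j))"

type_synonym index = "(nat \<times> nat) set list \<times> nat list"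

definition suffix_space :: "nat \<Rightarrow> nat \<Rightarrow> nat list \<Rightarrow> (nat list \<Rightarrow> complex) set"
  where "suffix_space n k c = cfun.span {delta w | w. w \<in> words n k \<and> suffix c w}"

definition joint_space :: "nat \<Rightarrow> nat \<Rightarrow> index \<Rightarrow> (nat list \<Rightarrow> complex) set"
  where "joint_space n k = (\<lambda>(L, c).
    (\<Inter>j<length L. isotypic n k (Suc j) (L ! j)) \<inter> suffix_space n k c)"

text \<open>
  The labels of the elements of the \<open>i\<close>-th basis. The bound \<open>a \<le> min r (i - r)\<close> is written so as to
  avoid truncated subtraction; for \<open>i = 0\<close> the chain is empty and \<open>r = 0\<close>.
\<close>

definition basis_index :: "nat \<Rightarrow> nat \<Rightarrow> nat \<Rightarrow> index set"
  where "basis_index n k i =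
    {(L, c). young_chain L \<and> length L = i \<and> length c = n - i \<and> set c \<subseteq> {1, 2} \<and>
      (\<exists>r\<le>k. count_list c 1 = k - r \<and>
        (\<exists>a. a \<le> r \<and> a + r \<le> i \<and> (i > 0 \<longrightarrow> last L = two_row i a)))}"

definition intermediate_bases :: "nat \<Rightarrow> nat \<Rightarrow> (nat \<Rightarrow> index \<Rightarrow> nat list \<Rightarrow> complex) \<Rightarrow> bool"
  where "intermediate_bases n k B \<longleftrightarrow>
    (\<forall>i\<le>n. \<forall>b\<in>basis_index n k i.
      B i b \<in> joint_space n k b \<and> winner n k (B i b) (B i b) = 1 \<and> (\<forall>w. B i b w \<in> \<real>)) \<and>
    (\<forall>w\<in>words n k. B 0 ([], w) = delta w) \<and>
    B 1 ` basis_index n k 1 = B 0 ` basis_index n k 0"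

definition coord :: "('i \<Rightarrow> 'a \<Rightarrow> complex) \<Rightarrow> 'i set \<Rightarrow> ('a \<Rightarrow> complex) \<Rightarrow> 'i \<Rightarrow> complex"
  where "coord b I f = (\<lambda>j. cfun.representation (b ` I) f (b j))"

section \<open>Isotypic projections\<close>

definition isotypic_parts :: "nat \<Rightarrow> nat \<Rightarrow> (nat list \<Rightarrow> complex) \<Rightarrow> nat \<Rightarrow> nat list \<Rightarrow> complex"
  where "isotypic_parts n k f = (THE g.
    (\<forall>a\<le>min k (n - k). g a \<in> isotypic n k n (two_row n a)) \<and>
    (\<forall>a>min k (n - k). g a = 0) \<and>
    f = (\<Sum>a\<le>min k (n - k). g a))"

definition isotypic_sum :: "nat \<Rightarrow> nat \<Rightarrow> nat set \<Rightarrow> (nat list \<Rightarrow> complex) \<Rightarrow> nat list \<Rightarrow> complex"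
  where "isotypic_sum n k H f = (\<Sum>a\<in>H. isotypic_parts n k f a)"

section \<open>Computational model\<close>

text \<open>
  Straight-line programs. The instruction \<open>(u, v, w)\<close> computes \<open>u * v + w\<close> and is a single operation.
  An operand is one of the constants 0 and 1, an input, or the result of an earlier instruction;
  access to operands is free.
\<close>

datatype 'v operand = Zero | One | Input 'v | Result nat

type_synonym 'v program = "('v operand \<times> 'v operand \<times> 'v operand) list"

fun operand_val :: "('v \<Rightarrow> complex) \<Rightarrow> complex list \<Rightarrow> 'v operand \<Rightarrow> complex" where
  "operand_val env rs Zero = 0"
| "operand_val env rs One = 1"
| "operand_val env rs (Input v) = env v"
| "operand_val env rs (Result m) = rs ! m"

definition run :: "('v \<Rightarrow> complex) \<Rightarrow> 'v program \<Rightarrow> complex list"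
  where "run env P = foldl (\<lambda>rs (u, v, w).
    rs @ [operand_val env rs u * operand_val env rs v + operand_val env rs w]) [] P"

fun operand_ok :: "'v set \<Rightarrow> nat \<Rightarrow> 'v operand \<Rightarrow> bool" where
  "operand_ok V m Zero = True"
| "operand_ok V m One = True"
| "operand_ok V m (Input v) = (v \<in> V)"
| "operand_ok V m (Result l) = (l < m)"

definition program_ok :: "'v set \<Rightarrow> 'v program \<Rightarrow> bool"
  where "program_ok V P \<longleftrightarrow> (\<forall>m<length P. case P ! m of (u, v, w) \<Rightarrow>
    operand_ok V m u \<and> operand_ok V m v \<and> operand_ok V m w)"

text \<open>
  The inputs: \<open>Coord b\<close> is the entry of the given column vector at \<open>b\<close>, and \<open>Entry i c d\<close> is the entry
  in row \<open>c\<close> and column \<open>d\<close> of the matrix whose columns are the elements of the basis \<open>i - 1\<close> written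
  in the basis \<open>i\<close>.
\<close>

datatype input = Coord index | Entry nat index index

definition inputs :: "nat \<Rightarrow> nat \<Rightarrow> input set"
  where "inputs n k = Coord ` basis_index n k 0 \<union>
    {Entry i c d | i c d. i \<in> {2..n} \<and> c \<in> basis_index n k i \<and> d \<in> basis_index n k (i - 1)}"

fun input_val ::
    "nat \<Rightarrow> nat \<Rightarrow> (nat \<Rightarrow> index \<Rightarrow> nat list \<Rightarrow> complex) \<Rightarrow> (nat list \<Rightarrow> complex) \<Rightarrow> input \<Rightarrow> complex" where
  "input_val n k B f (Coord b) = coord (B 0) (basis_index n k 0) f b"
| "input_val n k B f (Entry i c d) = coord (B i) (basis_index n k i) (B (i - 1) d) c"

end

theory Submission
  imports Defs
begin

text \<open>
  The class sum of transpositions of \<open>S\<^sub>i\<close> acts on the Specht module of a diagram by a scalar,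
  and these scalars separate the two-row diagrams with \<open>i\<close> boxes. The class sum is self-adjoint, so
  elements of \<open>B\<^sub>i\<close> with different chains are orthogonal, as are those with different suffixes, since
  their supports are disjoint. Likewise an element of \<open>B\<^sub>i\<close> is orthogonal to one of \<open>B\<^sub>i\<^sub>+\<^sub>1\<close> unless the
  chain and the suffix of the latter arise by adding a diagram and deleting a letter, which leaves at
  most two nonzero entries in each row and each column of the change of basis matrix. A change of
  basis in either direction thus costs at most twice \<open>n choose k\<close> operations; going from \<open>B\<^sub>0 = B\<^sub>1\<close> up to \<open>B\<^sub>n\<close>, discarding the coordinates outside the
  chosen isotypic components for free, and going down again with the transposed matrices gives
  the bound.
\<close>

section \<open>Straight-line programs\<close>

text \<open>The program is fixed before the bases and \<open>f\<close> are known, so the places of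
  possibly nonzero entries must be read off the labels alone; \<open>linked\<close> does this. Each
  such entry costs one instruction, because an instruction multiplies and adds at once. That each
  \<open>B i\<close> spans the whole function space is obtained by counting. Orthonormality bounds
  the number of labels by \<open>n choose k\<close> from above; \<open>extend_index\<close> embeds
  the labels of one level into those of the next, starting from the words themselves, and so bounds
  it from below. Only the matrices from \<open>B (i - 1)\<close> to \<open>B i\<close> are inputs.
  Going down is possible with the same entries because the basis vectors are real-valued, which
  makes their inner products symmetric. The existence of the bases is handled by a case distinction
  in the theorem; where they exist, a single program serves all choices of them.\<close>

lemma run_snoc:
  "run env (P @ [(u, v, w)]) =
    run env P @ [operand_val env (run env P) u * operand_val env (run env P) v
      + operand_val env (run env P) w]"
  by (simp add: run_def)

lemma length_run [simp]: "length (run env P) = length P"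
  by (induction P rule: rev_induct) (auto simp: run_snoc run_def[of env "[]"])

lemma run_append: "\<exists>rs. run env (P @ Q) = run env P @ rs"
proof (induction Q rule: rev_induct)
  case (snoc x Q)
  then obtain rs where "run env (P @ Q) = run env P @ rs" by blast
  then show ?case
    using run_snoc[of env "P @ Q"] by (cases x) auto
qed simp

lemma operand_val_append:
  assumes "operand_ok V (length P) a"
  shows "operand_val env (run env (P @ Q)) a = operand_val env (run env P) a"
proof -
  obtain rs where "run env (P @ Q) = run env P @ rs" using run_append by blast
  with assms show ?thesis by (cases a) (auto simp: nth_append)
qed

lemma operand_ok_mono: "operand_ok V m a \<Longrightarrow> m \<le> m' \<Longrightarrow> operand_ok V m' a"
  by (cases a) auto

lemma program_ok_snoc:
  assumes "program_ok V P" "operand_ok V (length P) u" "operand_ok V (length P) v"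
    "operand_ok V (length P) w"
  shows "program_ok V (P @ [(u, v, w)])"
  using assms by (auto simp: program_ok_def nth_append less_Suc_eq)

text \<open>Each summand is one fused multiplication and addition; the accumulator starts at the
  free constant \<open>Zero\<close>.\<close>

lemma dot_product_program:
  assumes "finite S" "program_ok V P" "\<And>d. d \<in> S \<Longrightarrow> e d \<in> V"
    and "\<And>d. d \<in> S \<Longrightarrow> operand_ok V (length P) (out d)"
  shows "\<exists>Q a. program_ok V (P @ Q) \<and> length Q = card S \<and> operand_ok V (length (P @ Q)) a \<and>
    (\<forall>env. operand_val env (run env (P @ Q)) a =
      (\<Sum>d\<in>S. env (e d) * operand_val env (run env P) (out d)))"
  using assms(1,3,4)
proof (induction S rule: finite_induct)
  case empty
  then show ?case using assms(2) by (intro exI[of _ "[]"] exI[of _ Zero]) auto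
next
  case (insert d S)
  then obtain Q a where Q: "program_ok V (P @ Q)" "length Q = card S"
      "operand_ok V (length (P @ Q)) a"
      "\<And>env. operand_val env (run env (P @ Q)) a =
        (\<Sum>d\<in>S. env (e d) * operand_val env (run env P) (out d))"
    by auto
  let ?Q = "Q @ [(Input (e d), out d, a)]"
  have out: "operand_ok V (length P) (out d)" using insert.prems by simp
  have "program_ok V (P @ ?Q)"
    using program_ok_snoc[OF Q(1), of "Input (e d)" "out d" a] Q(3) insert.prems(1)
      operand_ok_mono[OF out, of "length (P @ Q)"] by simp
  moreover have "operand_val env (run env (P @ ?Q)) (Result (length (P @ Q))) =
      (\<Sum>d\<in>insert d S. env (e d) * operand_val env (run env P) (out d))" for env
  proof -
    have "run env (P @ ?Q) ! length (P @ Q) = env (e d) * operand_val env (run env (P @ Q)) (out d)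
        + operand_val env (run env (P @ Q)) a"
      using run_snoc[of env "P @ Q" "Input (e d)" "out d" a]
      by (simp add: nth_append del: length_append)
    then show ?thesis
      using insert.hyps Q(4)[of env] operand_val_append[OF out, of env Q] by simp
  qed
  ultimately show ?case
    using Q(2) insert.hyps by (intro exI[of _ ?Q] exI[of _ "Result (length (P @ Q))"]) simp
qed

lemma sparse_matrix_vector_program:
  assumes "finite J" "program_ok V P"
    and "\<And>c. c \<in> J \<Longrightarrow> finite (S c) \<and> card (S c) \<le> m"
    and "\<And>c d. c \<in> J \<Longrightarrow> d \<in> S c \<Longrightarrow> e c d \<in> V \<and> operand_ok V (length P) (out d)"
  shows "\<exists>Q out'. program_ok V (P @ Q) \<and> length Q \<le> m * card J \<and>
    (\<forall>c\<in>J. operand_ok V (length (P @ Q)) (out' c) \<and>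
      (\<forall>env. operand_val env (run env (P @ Q)) (out' c) =
        (\<Sum>d\<in>S c. env (e c d) * operand_val env (run env P) (out d))))"
  using assms(1,3,4)
proof (induction J rule: finite_induct)
  case empty
  then show ?case using assms(2) by (intro exI[of _ "[]"]) auto
next
  case (insert c J)
  from insert.IH[OF insert.prems(1)[OF insertI2] insert.prems(2)[OF insertI2]]
  obtain Q out' where Q: "program_ok V (P @ Q)" "length Q \<le> m * card J"
    "\<And>c. c \<in> J \<Longrightarrow> operand_ok V (length (P @ Q)) (out' c)"
    "\<And>c env. c \<in> J \<Longrightarrow> operand_val env (run env (P @ Q)) (out' c) =
        (\<Sum>d\<in>S c. env (e c d) * operand_val env (run env P) (out d))"
    by blast
  have out: "operand_ok V (length P) (out d)" if "d \<in> S c" for d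
    using insert.prems(2) that by blast
  have "\<exists>R a. program_ok V ((P @ Q) @ R) \<and> length R = card (S c) \<and>
      operand_ok V (length ((P @ Q) @ R)) a \<and>
      (\<forall>env. operand_val env (run env ((P @ Q) @ R)) a =
        (\<Sum>d\<in>S c. env (e c d) * operand_val env (run env (P @ Q)) (out d)))"
    using insert.prems operand_ok_mono[OF out]
    by (intro dot_product_program Q) auto
  then obtain R a where R: "program_ok V ((P @ Q) @ R)" "length R = card (S c)"
      "operand_ok V (length ((P @ Q) @ R)) a"
      "\<And>env. operand_val env (run env ((P @ Q) @ R)) a =
        (\<Sum>d\<in>S c. env (e c d) * operand_val env (run env (P @ Q)) (out d))"
    by blast
  \<comment> \<open>Appending \<open>R\<close> for the new row leaves earlier results in place, so
    the old outputs stay valid.\<close>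
  have "operand_val env (run env (P @ Q @ R)) ((out'(c := a)) x) =
        (\<Sum>d\<in>S x. env (e x d) * operand_val env (run env P) (out d))"
    if "x \<in> insert c J" for x env
  proof (cases "x = c")
    case True
    then show ?thesis
      using R(4)[of env] by (auto simp: operand_val_append[OF out] intro!: sum.cong)
  next
    case False
    then show ?thesis
      using that Q(4)[of x env] operand_val_append[OF Q(3), of x env R] by auto
  qed
  moreover have "operand_ok V (length (P @ Q @ R)) ((out'(c := a)) x)" if "x \<in> insert c J" for x
    using that Q(3)[of x] R(3) operand_ok_mono by (cases "x = c") fastforce+
  moreover have "length (Q @ R) \<le> m * card (insert c J)"
    using Q(2) R(2) insert.hyps insert.prems(1)[of c] by (simp add: algebra_simps)
  ultimately show ?case
    using R(1) by (intro exI[of _ "Q @ R"] exI[of _ "out'(c := a)"]) simp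
qed

text \<open>The program and its output operands are chosen before \<open>x\<close>, so one program
  has to serve all data in \<open>X\<close>.\<close>

definition computable ::
    "'v set \<Rightarrow> ('p \<Rightarrow> 'v \<Rightarrow> complex) \<Rightarrow> 'p set \<Rightarrow> nat \<Rightarrow> 'j set \<Rightarrow> ('p \<Rightarrow> 'j \<Rightarrow> complex) \<Rightarrow> bool"
  where "computable V env X N J F \<longleftrightarrow> (\<exists>P out. program_ok V P \<and>
    (\<forall>j\<in>J. operand_ok V (length P) (out j)) \<and> length P \<le> N \<and>
    (\<forall>x\<in>X. \<forall>j\<in>J. operand_val (env x) (run (env x) P) (out j) = F x j))"

lemma computable_inputs:
  assumes "\<And>j. j \<in> J \<Longrightarrow> g j \<in> V" "\<And>x j. x \<in> X \<Longrightarrow> j \<in> J \<Longrightarrow> F x j = env x (g j)"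
  shows "computable V env X 0 J F"
  unfolding computable_def using assms
  by (intro exI[of _ "[]"] exI[of _ "\<lambda>j. Input (g j)"]) (auto simp: program_ok_def)

text \<open>Relabelling, dropping or zeroing coordinates only redirects output operands, which is
  free. This serves both the projection and the final passage from \<open>B 1\<close> to
  \<open>B 0\<close>.\<close>

lemma computable_select:
  assumes "computable V env X N J F" "\<And>j. j \<in> J' \<Longrightarrow> j \<notin> Z \<Longrightarrow> g j \<in> J"
    and "\<And>x j. x \<in> X \<Longrightarrow> j \<in> J' \<Longrightarrow> F' x j = (if j \<in> Z then 0 else F x (g j))"
  shows "computable V env X N J' F'"
proof -
  obtain P out where "program_ok V P" "\<forall>j\<in>J. operand_ok V (length P) (out j)" "length P \<le> N"
    "\<forall>x\<in>X. \<forall>j\<in>J. operand_val (env x) (run (env x) P) (out j) = F x j"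
    using assms(1) unfolding computable_def by blast
  then show ?thesis
    unfolding computable_def using assms(2,3)
    by (intro exI[of _ P] exI[of _ "\<lambda>j. if j \<in> Z then Zero else out (g j)"]) auto
qed

lemma computable_sparse_matrix_vector:
  assumes "computable V env X N J F" "finite J'"
    and "\<And>c. c \<in> J' \<Longrightarrow> finite (S c) \<and> card (S c) \<le> m \<and> S c \<subseteq> J"
    and "\<And>c d. c \<in> J' \<Longrightarrow> d \<in> S c \<Longrightarrow> e c d \<in> V"
    and "\<And>x c. x \<in> X \<Longrightarrow> c \<in> J' \<Longrightarrow> F' x c = (\<Sum>d\<in>S c. env x (e c d) * F x d)"
  shows "computable V env X (N + m * card J') J' F'"
proof -
  obtain P out where P: "program_ok V P" "\<And>j. j \<in> J \<Longrightarrow> operand_ok V (length P) (out j)"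
      "length P \<le> N"
      "\<And>x j. x \<in> X \<Longrightarrow> j \<in> J \<Longrightarrow> operand_val (env x) (run (env x) P) (out j) = F x j"
    using assms(1) unfolding computable_def by blast
  have "\<exists>Q out'. program_ok V (P @ Q) \<and> length Q \<le> m * card J' \<and>
    (\<forall>c\<in>J'. operand_ok V (length (P @ Q)) (out' c) \<and>
      (\<forall>env. operand_val env (run env (P @ Q)) (out' c) =
        (\<Sum>d\<in>S c. env (e c d) * operand_val env (run env P) (out d))))"
    using assms(3,4) P(2) by (intro sparse_matrix_vector_program assms(2) P(1)) blast+
  then obtain Q out' where Q: "program_ok V (P @ Q)" "length Q \<le> m * card J'"
      "\<And>c. c \<in> J' \<Longrightarrow> operand_ok V (length (P @ Q)) (out' c)"
      "\<And>c env. c \<in> J' \<Longrightarrow> operand_val env (run env (P @ Q)) (out' c) =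
        (\<Sum>d\<in>S c. env (e c d) * operand_val env (run env P) (out d))"
    by blast
  have "operand_val (env x) (run (env x) (P @ Q)) (out' c) = F' x c" if "x \<in> X" "c \<in> J'" for x c
    using that assms(3)[of c] by (auto simp: Q(4) assms(5) P(4) intro!: sum.cong)
  then show ?thesis
    unfolding computable_def using Q P(3)
    by (intro exI[of _ "P @ Q"] exI[of _ out']) auto
qed

section \<open>The class sum of transpositions on Specht modules\<close>

lemma sum_fun_apply: "(\<Sum>x\<in>A. f x) y = (\<Sum>x\<in>A. (f x y :: complex))"
  by (induction A rule: infinite_finite_induct) auto

lemma sum_swap_pairs:
  fixes f :: "'a \<Rightarrow> 'b \<Rightarrow> 'c \<Rightarrow> 'd \<Rightarrow> 'e::comm_monoid_add"
  shows "(\<Sum>x\<in>A. \<Sum>y\<in>B. \<Sum>p\<in>P. \<Sum>q\<in>Q. f x y p q) =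
    (\<Sum>p\<in>P. \<Sum>q\<in>Q. \<Sum>x\<in>A. \<Sum>y\<in>B. f x y p q)"
  unfolding sum.cartesian_product
  by (rule sum.reindex_bij_witness[where i = "\<lambda>(p, q, x, y). (x, y, p, q)"
        and j = "\<lambda>(x, y, p, q). (p, q, x, y)"]) auto

text \<open>
  Summing over ordered pairs counts each transposition twice and the identity \<open>i\<close> times, which only
  rescales and shifts the eigenvalues of the class sum.
\<close>

definition transposition_sum ::
    "nat \<Rightarrow> ((nat \<Rightarrow> nat) \<Rightarrow> ('a \<Rightarrow> complex) \<Rightarrow> 'a \<Rightarrow> complex) \<Rightarrow> ('a \<Rightarrow> complex) \<Rightarrow> 'a \<Rightarrow> complex"
  where "transposition_sum i act f = (\<Sum>x<i. \<Sum>y<i. act (transpose x y) f)"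

text \<open>For a Young diagram with \<open>i\<close> boxes this is \<open>i\<close> plus twice the
  sum of the contents (column minus row) of its boxes; the summand \<open>i\<close> comes from the
  pairs \<open>x = y\<close> in \<open>transposition_sum\<close>.\<close>

definition diagram_eigenvalue :: "(nat \<times> nat) set \<Rightarrow> complex"
  where "diagram_eigenvalue D =
    of_nat (card {(b, b') \<in> D \<times> D. fst b = fst b'}) -
    of_nat (card {(b, b') \<in> D \<times> D. fst b \<noteq> fst b' \<and> snd b = snd b'})"

text \<open>Taking \<open>fst\<close> or \<open>snd\<close> for \<open>pr\<close> treats row and
  column group at once. As conditions on entries, through the box \<open>inv_into D T m\<close> of
  the entry \<open>m\<close>, they are easily checked for products with transpositions.\<close>

lemma fibre_group_eq:
  assumes "bij_betw T D {..<i}"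
  shows "{p. p permutes {..<i} \<and> (\<forall>b\<in>D. \<exists>b'\<in>D. pr b' = pr b \<and> p (T b) = T b')} =
    {p. p permutes {..<i} \<and> (\<forall>m<i. pr (inv_into D T (p m)) = pr (inv_into D T m))}"
    (is "?L = ?R")
proof -
  have inv: "inv_into D T (T b) = b" if "b \<in> D" for b
    using assms that by (auto simp: bij_betw_def)
  have T: "m < i \<longleftrightarrow> (\<exists>b\<in>D. m = T b)" for m
    using assms by (auto simp: bij_betw_def)
  have "(\<forall>b\<in>D. \<exists>b'\<in>D. pr b' = pr b \<and> p (T b) = T b') \<longleftrightarrow>
      (\<forall>m<i. pr (inv_into D T (p m)) = pr (inv_into D T m))" if p: "p permutes {..<i}" for p
  proof -
    have "(\<exists>b'\<in>D. pr b' = pr b \<and> p (T b) = T b') \<longleftrightarrow> pr (inv_into D T (p (T b))) = pr b"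
      if "b \<in> D" for b
    proof -
      have "p (T b) < i" using permutes_in_image[OF p, of "T b"] T that by auto
      then obtain b0 where "b0 \<in> D" "p (T b) = T b0" using T by blast
      then show ?thesis using inv by metis
    qed
    moreover have "(\<forall>m<i. pr (inv_into D T (p m)) = pr (inv_into D T m)) \<longleftrightarrow>
        (\<forall>b\<in>D. pr (inv_into D T (p (T b))) = pr b)"
      using T inv by auto
    ultimately show ?thesis by simp
  qed
  then show ?thesis by blast
qed

lemma transpose_cancel: "transpose x y \<circ> (transpose x y \<circ> h) = h"
  by (simp add: fun_eq_iff)

text \<open>
  Centrality moves the transposition \<open>t\<close> between the two factors \<open>P\<close>, \<open>Q\<close> of the symmetrizer.
  There \<open>P t Q\<close> is \<open>P Q\<close> if \<open>t\<close> preserves rows and \<open>- P Q\<close> if it preserves columns. If \<open>t\<close>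
  exchanges \<open>x\<close> in an upper row with \<open>y\<close> in a lower row and another column, let \<open>z\<close> be the entry in
  the row of \<open>x\<close> and the column of \<open>y\<close>: then \<open>P t Q = P (x z) t Q = P t (y z) Q = - P t Q\<close>.
\<close>

lemma transposition_sum_young_symmetrizer:
  assumes D: "D \<in> young_diagrams i" and T: "tableau i D T"
  shows "transposition_sum i left_mult (young_symmetrizer i D T) =
    fscale (diagram_eigenvalue D) (young_symmetrizer i D T)"
proof
  fix \<tau>
  define \<rho> where "\<rho> m = fst (inv_into D T m)" for m
  define \<kappa> where "\<kappa> m = snd (inv_into D T m)" for m
  define R where "R = {p. p permutes {..<i} \<and> (\<forall>m<i. \<rho> (p m) = \<rho> m)}"
  define C where "C = {q. q permutes {..<i} \<and> (\<forall>m<i. \<kappa> (q m) = \<kappa> m)}"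
  \<comment> \<open>The coefficient at \<open>\<tau>\<close> of the product of the row sum,
    \<open>s\<close> and the signed column sum; \<open>G id\<close> is thus the value of the
    symmetrizer at \<open>\<tau>\<close>.\<close>
  define G where
    "G s = (\<Sum>p\<in>R. \<Sum>q\<in>C. if p \<circ> s \<circ> q = \<tau> then of_int (sign q) else (0::complex))" for s
  have bij: "bij_betw T D {..<i}" using T by (simp add: tableau_def)
  have R: "row_group i D T = R" and C: "col_group i D T = C"
    unfolding row_group_def col_group_def fibre_group_eq[OF bij] R_def C_def \<rho>_def \<kappa>_def by simp_all
  have fin: "finite R" "finite C"
    by (rule finite_subset[OF _ finite_permutations[of "{..<i}"]], auto simp: R_def C_def)+
  have Rp: "p permutes {..<i}" if "p \<in> R" for p using that by (simp add: R_def)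
  have Cp: "permutation q" if "q \<in> C" for q
    using that permutation_permutes by (auto simp: C_def)
  have ys: "young_symmetrizer i D T \<sigma> =
      (\<Sum>p\<in>R. \<Sum>q\<in>C. if p \<circ> q = \<sigma> then of_int (sign q) else 0)" for \<sigma>
  proof -
    have "young_symmetrizer i D T \<sigma> =
        (\<Sum>(p, q)\<in>{(p, q) \<in> R \<times> C. p \<circ> q = \<sigma>}. of_int (sign q))"
      unfolding young_symmetrizer_def R C by (rule arg_cong[where f = "sum _"]) auto
    also have "\<dots> = (\<Sum>x\<in>R \<times> C. if fst x \<circ> snd x = \<sigma> then of_int (sign (snd x)) else 0)"
      using fin by (intro sum.mono_neutral_cong_left) auto
    finally show ?thesis by (simp add: sum.cartesian_product case_prod_unfold)
  qed
  have R_transpose: "p \<circ> transpose x y \<in> R" if "p \<in> R" "x < i" "y < i" "\<rho> x = \<rho> y" for p x y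
  proof -
    have "p \<circ> transpose x y permutes {..<i}"
      using that by (simp add: R_def permutes_compose permutes_swap_id)
    moreover have "transpose x y m < i \<and> \<rho> (transpose x y m) = \<rho> m" if "m < i" for m
      using \<open>x < i\<close> \<open>y < i\<close> \<open>\<rho> x = \<rho> y\<close> that by (simp add: transpose_def)
    ultimately show ?thesis using that(1) by (simp add: R_def)
  qed
  have C_transpose: "transpose x y \<circ> q \<in> C" if "q \<in> C" "x < i" "y < i" "\<kappa> x = \<kappa> y" for q x y
  proof -
    have "transpose x y \<circ> q permutes {..<i}"
      using that by (simp add: C_def permutes_compose permutes_swap_id)
    moreover have "\<kappa> (transpose x y m) = \<kappa> m" for m
      using \<open>\<kappa> x = \<kappa> y\<close> by (simp add: transpose_def)
    ultimately show ?thesis using that(1) by (simp add: C_def)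
  qed
  have sgn: "sign (transpose x y \<circ> q) = - sign q" if "q \<in> C" "x \<noteq> y" for q x y
    using that by (simp add: sign_compose Cp permutation_swap_id sign_swap_id)

  have G_row: "G (transpose x y) = G id" if "x < i" "y < i" "\<rho> x = \<rho> y" for x y
    unfolding G_def
    by (rule sum.reindex_bij_witness[where i = "\<lambda>p. p \<circ> transpose x y"
          and j = "\<lambda>p. p \<circ> transpose x y"])
      (simp_all add: comp_assoc R_transpose that)
  have G_col: "G (transpose x y) = - G id" if "x < i" "y < i" "x \<noteq> y" "\<kappa> x = \<kappa> y" for x y
    unfolding G_def sum_negf[symmetric]
    by (rule sum.cong[OF refl], rule sum.reindex_bij_witness[where i = "\<lambda>q. transpose x y \<circ> q"
          and j = "\<lambda>q. transpose x y \<circ> q"])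
(simp_all add: C_transpose that sgn comp_assoc transpose_cancel)
  have G_zero: "G (transpose x y) = 0" if xy: "x < i" "y < i" "\<rho> x < \<rho> y" "\<kappa> x \<noteq> \<kappa> y" for x y
  proof -
    have inD: "inv_into D T m \<in> D" if "m < i" for m
      using bij that by (metis bij_betw_def inv_into_into lessThan_iff)
    have "(\<rho> y, \<kappa> y) \<in> D" using inD[OF xy(2)] by (simp add: \<rho>_def \<kappa>_def)
    then have zD: "(\<rho> x, \<kappa> y) \<in> D"
      using D xy(3) by (fastforce simp: young_diagrams_def)
    define z where "z = T (\<rho> x, \<kappa> y)"
    have z: "z < i" "\<rho> z = \<rho> x" "\<kappa> z = \<kappa> y"
      using zD bij unfolding z_def \<rho>_def \<kappa>_def by (auto simp: bij_betw_def)
    have "z \<noteq> x" "z \<noteq> y" using z xy by auto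
    have swap: "transpose x z \<circ> transpose x y \<circ> transpose y z = transpose x y"
      using \<open>z \<noteq> x\<close> \<open>z \<noteq> y\<close> by (auto simp: fun_eq_iff transpose_def)
    have "G (transpose x y) = (\<Sum>p\<in>R. \<Sum>q\<in>C.
        if (p \<circ> transpose x z) \<circ> transpose x y \<circ> q = \<tau> then of_int (sign q) else 0)"
      unfolding G_def
      by (rule sum.reindex_bij_witness[where i = "\<lambda>p. p \<circ> transpose x z"
            and j = "\<lambda>p. p \<circ> transpose x z"])
        (simp_all add: comp_assoc R_transpose xy z)
    also have "\<dots> = (\<Sum>p\<in>R. \<Sum>q\<in>C. - (if p \<circ> transpose x y \<circ> q = \<tau> then of_int (sign q) else 0))"
    proof (rule sum.cong[OF refl], rule sum.reindex_bij_witness[where i = "\<lambda>q. transpose y z \<circ> q"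
            and j = "\<lambda>q. transpose y z \<circ> q"])
      fix p :: "nat \<Rightarrow> nat" and q assume q: "q \<in> C"
      have "p \<circ> transpose x z \<circ> transpose x y \<circ> (transpose y z \<circ> q) = p \<circ> transpose x y \<circ> q"
        using swap by (metis comp_assoc)
      moreover have "p \<circ> transpose x z \<circ> transpose x y \<circ> q =
          p \<circ> (transpose x z \<circ> transpose x y \<circ> transpose y z) \<circ> (transpose y z \<circ> q)"
        by (simp add: fun_eq_iff)
      ultimately show "- (if p \<circ> transpose x y \<circ> (transpose y z \<circ> q) = \<tau>
          then complex_of_int (sign (transpose y z \<circ> q)) else 0) =
          (if p \<circ> transpose x z \<circ> transpose x y \<circ> q = \<tau> then of_int (sign q) else 0)"
        using sgn[OF q, of y z] \<open>z \<noteq> y\<close> swap by simp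
    qed (simp_all add: C_transpose xy z transpose_cancel)
    also have "\<dots> = - G (transpose x y)" by (simp add: G_def sum_negf)
    finally show ?thesis by simp
  qed

  \<comment> \<open>The first case includes \<open>x = y\<close>. If \<open>y\<close> lies in the
    upper row, \<open>G_zero\<close> is applied with \<open>x\<close> and \<open>y\<close>
    exchanged.\<close>
  have *: "G (transpose x y) = (if \<rho> x = \<rho> y then 1 else if \<kappa> x = \<kappa> y then -1 else 0) * G id"
    if "x < i" "y < i" for x y
    using that G_row[of x y] G_col[of x y] G_zero[of x y] G_zero[of y x]
    by (cases "\<rho> x" "\<rho> y" rule: linorder_cases) (auto simp: transpose_commute)

  have "transposition_sum i left_mult (young_symmetrizer i D T) \<tau> =
      (\<Sum>x<i. \<Sum>y<i. \<Sum>p\<in>R. \<Sum>q\<in>C. if transpose x y \<circ> p \<circ> q = \<tau> then of_int (sign q) else 0)"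
  proof -
    have "p \<circ> q = transpose x y \<circ> \<tau> \<longleftrightarrow> transpose x y \<circ> p \<circ> q = \<tau>" for p q :: "nat \<Rightarrow> nat" and x y
      using transpose_cancel[of x y \<tau>] transpose_cancel[of x y "p \<circ> q"]
      by (auto simp only: comp_assoc)
    then show ?thesis
      by (simp add: transposition_sum_def left_mult_def ys sum_fun_apply)
  qed
  also have "\<dots> =
      (\<Sum>p\<in>R. \<Sum>q\<in>C. \<Sum>x<i. \<Sum>y<i. if transpose x y \<circ> p \<circ> q = \<tau> then of_int (sign q) else 0)"
    by (rule sum_swap_pairs)
  also have "\<dots> =
      (\<Sum>p\<in>R. \<Sum>q\<in>C. \<Sum>x<i. \<Sum>y<i. if p \<circ> transpose x y \<circ> q = \<tau> then of_int (sign q) else 0)"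
  proof (rule sum.cong[OF refl], rule sum.cong[OF refl])
    fix p and q :: "nat \<Rightarrow> nat" assume p: "p \<in> R"
    let ?h = "\<lambda>x y. if transpose x y \<circ> p \<circ> q = \<tau> then complex_of_int (sign q) else 0"
    \<comment> \<open>Reindexing all pairs by \<open>p\<close> conjugates the transposition, which
      then passes to the right of \<open>p\<close>.\<close>
    have "(\<Sum>x<i. \<Sum>y<i. ?h x y) = (\<Sum>x<i. \<Sum>y<i. ?h (p x) (p y))"
      using sum.permute[OF Rp[OF p], of "\<lambda>x. \<Sum>y<i. ?h x y"]
        sum.permute[OF Rp[OF p], of "\<lambda>y. ?h x y" for x] by (simp add: comp_def)
    moreover have "transpose (p x) (p y) \<circ> p = p \<circ> transpose x y" for x y
      using permutes_bij[OF Rp[OF p]] transpose_comp_eq[of p "p x" "p y"]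
      by (simp add: bij_is_inj)
    ultimately show "(\<Sum>x<i. \<Sum>y<i. ?h x y) =
        (\<Sum>x<i. \<Sum>y<i. if p \<circ> transpose x y \<circ> q = \<tau> then complex_of_int (sign q) else 0)"
      by simp
  qed
  also have "\<dots> = (\<Sum>x<i. \<Sum>y<i. G (transpose x y))"
    unfolding G_def by (rule sum_swap_pairs)
  also have "\<dots> =
      (\<Sum>x<i. \<Sum>y<i. if \<rho> x = \<rho> y then 1 else if \<kappa> x = \<kappa> y then -1 else 0) * G id"
    by (simp add: * sum_distrib_right)
  \<comment> \<open>The tableau matches pairs of entries with pairs of boxes, so its choice
    disappears from the scalar.\<close>
  also have "(\<Sum>x<i. \<Sum>y<i. if \<rho> x = \<rho> y then 1 else if \<kappa> x = \<kappa> y then -1 else (0::complex)) =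
      (\<Sum>b\<in>D. \<Sum>b'\<in>D. if fst b = fst b' then 1 else if snd b = snd b' then -1 else 0)"
  proof -
    have inv: "inv_into D T (T b) = b" if "b \<in> D" for b
      using bij that by (auto simp: bij_betw_def)
    show ?thesis
      by (auto simp: sum.reindex_bij_betw[OF bij, symmetric] \<rho>_def \<kappa>_def inv intro!: sum.cong)
  qed
  also have "\<dots> = diagram_eigenvalue D"
  proof -
    have "finite D" using D by (simp add: young_diagrams_def)
    then have card: "complex_of_nat (card {(b, b') \<in> D \<times> D. Q b b'}) =
        (\<Sum>b\<in>D. \<Sum>b'\<in>D. if Q b b' then 1 else 0)" for Q
    proof -
      have "complex_of_nat (card {(b, b') \<in> D \<times> D. Q b b'}) =
          (\<Sum>(b, b')\<in>{(b, b') \<in> D \<times> D. Q b b'}. 1)" by (simp add: case_prod_unfold)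
      also have "\<dots> = (\<Sum>(b, b')\<in>D \<times> D. if Q b b' then 1 else 0)"
        using \<open>finite D\<close> by (intro sum.mono_neutral_cong_left) (auto split: if_splits)
      finally show ?thesis by (simp add: sum.cartesian_product)
    qed
    show ?thesis
      unfolding diagram_eigenvalue_def card sum_subtractf[symmetric] by (intro sum.cong refl) auto
  qed
  also have "diagram_eigenvalue D * G id =
      fscale (diagram_eigenvalue D) (young_symmetrizer i D T) \<tau>"
    by (simp add: fscale_def ys G_def)
  finally show "transposition_sum i left_mult (young_symmetrizer i D T) \<tau> =
      fscale (diagram_eigenvalue D) (young_symmetrizer i D T) \<tau>" .
qed

lemma subspace_transposition_sum_eigenspace:
  assumes "\<And>\<sigma> f g. act \<sigma> (f + g) = act \<sigma> f + act \<sigma> g"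
    and "\<And>\<sigma> a f. act \<sigma> (fscale a f) = fscale a (act \<sigma> f)"
  shows "cfun.subspace {f. transposition_sum i act f = fscale c f}"
proof -
  have "transposition_sum i act (f + g) = transposition_sum i act f + transposition_sum i act g"
    for f g by (simp add: transposition_sum_def assms sum.distrib)
  moreover have "transposition_sum i act (fscale a f) = fscale a (transposition_sum i act f)" for a f
    by (simp add: transposition_sum_def assms cfun.scale_sum_right)
  moreover from this[of 0 0] have "transposition_sum i act 0 = 0" by simp
  ultimately show ?thesis
    by (auto simp: cfun.subspace_def cfun.scale_right_distrib mult.commute)
qed

section \<open>From the symmetrizer to Specht modules and isotypic components\<close>

lemma left_mult_linear:
  "left_mult \<sigma> (f + g) = left_mult \<sigma> f + left_mult \<sigma> g"
  "left_mult \<sigma> (fscale a f) = fscale a (left_mult \<sigma> f)"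
  by (auto simp: left_mult_def fscale_def)

lemma wfun_act_linear:
  "wfun_act \<sigma> (f + g) = wfun_act \<sigma> f + wfun_act \<sigma> g"
  "wfun_act \<sigma> (fscale a f) = fscale a (wfun_act \<sigma> f)"
  by (auto simp: wfun_act_def fscale_def)

text \<open>Conjugation by \<open>\<sigma>\<close> permutes the pairs of points below
  \<open>i\<close>, so the sum is central in the group algebra.\<close>

lemma transposition_sum_left_mult:
  assumes \<sigma>: "\<sigma> permutes {..<i}"
  shows "transposition_sum i left_mult (left_mult \<sigma> v) =
    left_mult \<sigma> (transposition_sum i left_mult v)"
proof
  fix \<tau>
  have perm: "inv \<sigma> permutes {..<i}" using permutes_inv[OF \<sigma>] .
  let ?h = "\<lambda>x y. v (transpose x y \<circ> (inv \<sigma> \<circ> \<tau>))"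
  have "inv \<sigma> \<circ> transpose x y = transpose (inv \<sigma> x) (inv \<sigma> y) \<circ> inv \<sigma>" for x y
    using transpose_comp_eq[of "inv \<sigma>" "inv \<sigma> x" "inv \<sigma> y"] permutes_bij[OF perm]
    by (simp add: bij_is_inj)
  then have "inv \<sigma> \<circ> (transpose x y \<circ> \<tau>) = transpose (inv \<sigma> x) (inv \<sigma> y) \<circ> (inv \<sigma> \<circ> \<tau>)" for x y
    by (metis comp_assoc)
  then have "transposition_sum i left_mult (left_mult \<sigma> v) \<tau> =
      (\<Sum>x<i. \<Sum>y<i. ?h (inv \<sigma> x) (inv \<sigma> y))"
    by (simp add: transposition_sum_def left_mult_def sum_fun_apply)
  also have "\<dots> = (\<Sum>x<i. \<Sum>y<i. ?h x y)"
    using sum.permute[OF perm, of "\<lambda>x. \<Sum>y<i. ?h x y"]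
      sum.permute[OF perm, of "\<lambda>y. ?h x y" for x] by (simp add: comp_def)
  also have "\<dots> = left_mult \<sigma> (transposition_sum i left_mult v) \<tau>"
    by (simp add: transposition_sum_def left_mult_def sum_fun_apply)
  finally show "transposition_sum i left_mult (left_mult \<sigma> v) \<tau> =
      left_mult \<sigma> (transposition_sum i left_mult v) \<tau>" .
qed

lemma transposition_sum_specht:
  assumes "D \<in> young_diagrams i" "tableau i D T" "v \<in> specht i D T"
  shows "transposition_sum i left_mult v = fscale (diagram_eigenvalue D) v"
proof -
  let ?E = "{f. transposition_sum i left_mult f = fscale (diagram_eigenvalue D) f}"
  have "specht i D T \<subseteq> ?E"
    unfolding specht_def
  proof (rule cfun.span_minimal)
    show "cfun.subspace ?E"
      by (rule subspace_transposition_sum_eigenspace) (rule left_mult_linear)+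
    show "{left_mult \<sigma> (young_symmetrizer i D T) |\<sigma>. \<sigma> permutes {..<i}} \<subseteq> ?E"
      using assms by (auto simp: transposition_sum_left_mult transposition_sum_young_symmetrizer
          left_mult_linear)
  qed
  with assms(3) show ?thesis by blast
qed

text \<open>The isomorphism in \<open>rep_iso\<close> is additive and equivariant only on the Specht
  module, so each translate must be known to lie there.\<close>

lemma left_mult_specht:
  assumes \<sigma>: "\<sigma> permutes {..<i}" and "v \<in> specht i D T"
  shows "left_mult \<sigma> v \<in> specht i D T"
proof -
  have "specht i D T \<subseteq> {v. left_mult \<sigma> v \<in> specht i D T}"
    unfolding specht_def
  proof (rule cfun.span_minimal)
    have zero: "left_mult \<sigma> 0 = 0" by (auto simp: left_mult_def)
    show "cfun.subspace {v. left_mult \<sigma> v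
        \<in> cfun.span {left_mult \<sigma> (young_symmetrizer i D T) |\<sigma>. \<sigma> permutes {..<i}}}"
      by (auto simp: cfun.subspace_def left_mult_linear zero
          intro: cfun.span_zero cfun.span_add cfun.span_scale)
    have "left_mult \<sigma> (left_mult \<pi> w) = left_mult (\<sigma> \<circ> \<pi>) w" if "\<pi> permutes {..<i}" for \<pi> w
      using permutes_bij[OF \<sigma>] permutes_bij[OF that]
      by (auto simp: left_mult_def o_inv_distrib comp_assoc)
    then show "{left_mult \<sigma> (young_symmetrizer i D T) |\<sigma>. \<sigma> permutes {..<i}} \<subseteq>
      {v. left_mult \<sigma> v \<in> cfun.span {left_mult \<sigma> (young_symmetrizer i D T) |\<sigma>. \<sigma> permutes {..<i}}}"
      using permutes_compose[OF _ \<sigma>] by (fastforce intro!: cfun.span_base)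
  qed
  with assms(2) show ?thesis by blast
qed

lemma subspace_wfuns: "cfun.subspace (wfuns n k)"
  by (auto simp: cfun.subspace_def wfuns_def fscale_def)

lemma isotypic_subset_wfuns: "isotypic n k i D \<subseteq> wfuns n k"
  unfolding isotypic_def by (rule cfun.span_minimal) (auto simp: subspace_wfuns)

lemma isotypic_eigenvector:
  assumes D: "D \<in> young_diagrams i" and f: "f \<in> isotypic n k i D"
  shows "transposition_sum i wfun_act f = fscale (diagram_eigenvalue D) f"
proof -
  let ?E = "{f. transposition_sum i wfun_act f = fscale (diagram_eigenvalue D) f}"
  have "W \<subseteq> ?E" if T: "tableau i D T" and iso: "rep_iso i left_mult (specht i D T) wfun_act W" for W T
  proof
    fix w assume "w \<in> W"
    let ?V = "specht i D T"
    obtain \<phi> where \<phi>: "bij_betw \<phi> ?V W"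
        "\<And>x y. x \<in> ?V \<Longrightarrow> y \<in> ?V \<Longrightarrow> \<phi> (x + y) = \<phi> x + \<phi> y"
        "\<And>c x. x \<in> ?V \<Longrightarrow> \<phi> (fscale c x) = fscale c (\<phi> x)"
        "\<And>\<sigma> x. \<sigma> permutes {..<i} \<Longrightarrow> x \<in> ?V \<Longrightarrow> \<phi> (left_mult \<sigma> x) = wfun_act \<sigma> (\<phi> x)"
      using iso unfolding rep_iso_def by blast
    obtain x where x: "x \<in> ?V" "w = \<phi> x"
      using \<phi>(1) \<open>w \<in> W\<close> by (auto simp: bij_betw_def)
    have zero: "0 \<in> ?V" by (simp add: specht_def cfun.span_zero)
    have plus: "x + y \<in> ?V" if "x \<in> ?V" "y \<in> ?V" for x y
      using that by (simp only: specht_def cfun.span_add)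
    have "\<phi> 0 = 0" using \<phi>(3)[OF zero, of 0] by simp
    \<comment> \<open>Additivity is available only inside \<open>?V\<close>, so membership of the
      partial sums is carried through the same induction.\<close>
    have \<phi>_sum: "\<phi> (sum h A) = (\<Sum>a\<in>A. \<phi> (h a)) \<and> sum h A \<in> ?V"
      if "\<And>a. a \<in> A \<Longrightarrow> h a \<in> ?V" for h and A :: "nat set"
      using that by (induction A rule: infinite_finite_induct)
        (auto simp only: sum.infinite sum.empty sum.insert zero \<open>\<phi> 0 = 0\<close> \<phi>(2) plus insert_iff
            simp_thms)
    have t: "transpose a b permutes {..<i}" if "a < i" "b < i" for a b
      using that by (simp add: permutes_swap_id)
    have V: "left_mult (transpose a b) x \<in> ?V" if "a < i" "b < i" for a b
      using t[OF that] x(1) by (rule left_mult_specht)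
    have "\<phi> (transposition_sum i left_mult x) =
        (\<Sum>a<i. \<phi> (\<Sum>b<i. left_mult (transpose a b) x))"
      unfolding transposition_sum_def by (rule \<phi>_sum[THEN conjunct1], rule \<phi>_sum[THEN conjunct2])
        (simp add: V)
    also have "\<dots> = (\<Sum>a<i. \<Sum>b<i. \<phi> (left_mult (transpose a b) x))"
      by (rule sum.cong[OF refl], rule \<phi>_sum[THEN conjunct1]) (simp add: V)
    also have "\<dots> = transposition_sum i wfun_act w"
      using x t by (simp add: transposition_sum_def \<phi>(4))
    finally have "\<phi> (transposition_sum i left_mult x) = transposition_sum i wfun_act w" .
    then show "w \<in> ?E"
      using transposition_sum_specht[OF D T x(1)] \<phi>(3) x by simp
  qed
  then have "isotypic n k i D \<subseteq> ?E"
    unfolding isotypic_def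
    by (intro cfun.span_minimal subspace_transposition_sum_eigenspace wfun_act_linear) blast
  with f show ?thesis by blast
qed

section \<open>Orthogonality of isotypic components\<close>

lemma finite_words [simp]: "finite (words n k)"
  by (rule finite_subset[OF _ finite_lists_length_eq[of "{1, 2}" n]]) (auto simp: words_def)

lemma words_Suc: "words (Suc n) (Suc k) = Cons 1 ` words n k \<union> Cons 2 ` words n (Suc k)"
  "words (Suc n) 0 = Cons 2 ` words n 0"
  by (auto simp: words_def length_Suc_conv image_iff split: if_splits)

lemma card_words: "card (words n k) = n choose k"
proof (induction n arbitrary: k)
  case 0
  have "words 0 k = (if k = 0 then {[]} else {})" by (auto simp: words_def)
  then show ?case by (cases k) auto
next
  case (Suc n)
  have "Cons 1 ` words n j \<inter> Cons 2 ` words n l = {}" for j l by auto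
  then show ?case
    using Suc by (cases k) (simp_all add: words_Suc card_image card_Un_disjoint)
qed

lemma winner_linear:
  "winner n k (f + f') g = winner n k f g + winner n k f' g"
  "winner n k (fscale c f) g = c * winner n k f g"
  "winner n k f (fscale c g) = cnj c * winner n k f g"
  "winner n k 0 g = 0"
  "winner n k (sum h A) g = (\<Sum>a\<in>A. winner n k (h a) g)"
proof -
  show *: "winner n k (f + f') g = winner n k f g + winner n k f' g" for f f'
    by (simp add: winner_def algebra_simps sum.distrib)
  show zero: "winner n k 0 g = 0" by (simp add: winner_def)
  show "winner n k (sum h A) g = (\<Sum>a\<in>A. winner n k (h a) g)"
    by (induction A rule: infinite_finite_induct)
      (simp_all only: sum.infinite sum.empty sum.insert * zero not_False_eq_True)
qed (auto simp: winner_def fscale_def algebra_simps sum_distrib_left)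

lemma winner_eq_0_imp:
  assumes "f \<in> wfuns n k" "winner n k f f = 0"
  shows "f = 0"
proof -
  have "winner n k f f = of_real (\<Sum>w\<in>words n k. (cmod (f w))\<^sup>2)"
    by (simp add: winner_def complex_norm_square[symmetric])
  then have "(\<Sum>w\<in>words n k. (cmod (f w))\<^sup>2) = 0"
    using assms(2) by (metis of_real_eq_0_iff)
  then have "\<forall>w\<in>words n k. f w = 0"
    by (simp add: sum_nonneg_eq_0_iff)
  then show ?thesis using assms(1) by (auto simp: wfuns_def fun_eq_iff)
qed

lemma wfun_act_transpose: "wfun_act (transpose x y) f w = f (permute_list (transpose x y) w)"
  by (simp add: wfun_act_def word_act_def)

text \<open>A transposition of positions is an involution on the words and keeps the number of
  letters 1, so reindexing moves it to the other argument.\<close>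

lemma winner_wfun_act_transpose:
  assumes "x < n" "y < n"
  shows "winner n k (wfun_act (transpose x y) f) g = winner n k f (wfun_act (transpose x y) g)"
proof -
  let ?t = "permute_list (transpose x y)"
  have t: "transpose x y permutes {..<n}" using assms by (simp add: permutes_swap_id)
  have count: "count_list (?t w) a = count_list w a" if "length w = n" for w :: "nat list" and a
    using that t mset_permute_list[of "transpose x y" w] by (metis count_mset)
  have "?t w \<in> words n k" if "w \<in> words n k" for w
    using that t by (auto simp: words_def count)
  moreover have "?t (?t w) = w" if "w \<in> words n k" for w
    using that t permute_list_compose[of "transpose x y" w "transpose x y"]
    by (auto simp: words_def)
  ultimately show ?thesis
    unfolding winner_def
    by (intro sum.reindex_bij_witness[where i = ?t and j = ?t]) (auto simp: wfun_act_transpose)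
qed

lemma winner_cnj: "winner n k g f = cnj (winner n k f g)"
  by (simp add: winner_def mult.commute)

lemma winner_transposition_sum:
  assumes "i \<le> n"
  shows "winner n k (transposition_sum i wfun_act f) g = winner n k f (transposition_sum i wfun_act g)"
proof -
  have "winner n k f (transposition_sum i wfun_act g) =
      (\<Sum>x<i. \<Sum>y<i. winner n k f (wfun_act (transpose x y) g))"
    by (subst winner_cnj) (simp add: transposition_sum_def winner_linear winner_cnj[of n k f])
  also have "\<dots> = winner n k (transposition_sum i wfun_act f) g"
    using assms by (simp add: transposition_sum_def winner_linear winner_wfun_act_transpose)
  finally show ?thesis by simp
qed

lemma isotypic_orthogonal:
  assumes "i \<le> n" "D \<in> young_diagrams i" "E \<in> young_diagrams i"
    and "diagram_eigenvalue D \<noteq> diagram_eigenvalue E"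
    and "f \<in> isotypic n k i D" "g \<in> isotypic n k i E"
  shows "winner n k f g = 0"
proof -
  have "diagram_eigenvalue D * winner n k f g = cnj (diagram_eigenvalue E) * winner n k f g"
    using winner_transposition_sum[OF assms(1), of k f g] assms(2,3,5,6)
    by (simp add: isotypic_eigenvector winner_linear)
  moreover have "cnj (diagram_eigenvalue E) = diagram_eigenvalue E"
    by (simp add: diagram_eigenvalue_def)
  ultimately show ?thesis using assms(4) by simp
qed

section \<open>Two-row diagrams\<close>

lemma two_row_young_diagram: "2 * a \<le> i \<Longrightarrow> two_row i a \<in> young_diagrams i"
  unfolding young_diagrams_def two_row_def
  by (subst mem_Collect_eq, subst card_Un_disjoint) (auto simp: card_cartesian_product)

lemma diagram_eigenvalue_two_row:
  assumes "2 * a \<le> i"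
  shows "diagram_eigenvalue (two_row i a) = of_int ((int i - int a)\<^sup>2 + (int a)\<^sup>2 - 2 * int a)"
proof -
  let ?A = "{0} \<times> {..<i - a} :: (nat \<times> nat) set" and ?B = "{1} \<times> {..<a} :: (nat \<times> nat) set"
  have "{(b, b') \<in> two_row i a \<times> two_row i a. fst b = fst b'} = ?A \<times> ?A \<union> ?B \<times> ?B"
    by (auto simp: two_row_def)
  moreover have "card (?A \<times> ?A \<union> ?B \<times> ?B) = (i - a)\<^sup>2 + a\<^sup>2"
    by (subst card_Un_disjoint) (auto simp: card_cartesian_product power2_eq_square)
  \<comment> \<open>Since \<open>2 * a \<le> i\<close>, exactly the first \<open>a\<close> columns
    have two boxes, and each gives two ordered pairs.\<close>
  moreover have "{(b, b') \<in> two_row i a \<times> two_row i a. fst b \<noteq> fst b' \<and> snd b = snd b'} =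
      (\<lambda>c. ((0, c), (1, c))) ` {..<a} \<union> (\<lambda>c. ((1, c), (0, c))) ` {..<a}"
    using assms by (auto simp: two_row_def)
  moreover have "card ((\<lambda>c. ((0::nat, c), (1::nat, c))) ` {..<a} \<union> (\<lambda>c. ((1, c), (0, c))) ` {..<a}) = 2 * a"
    by (subst card_Un_disjoint) (auto simp: card_image inj_on_def)
  ultimately show ?thesis
    using assms by (simp add: diagram_eigenvalue_def of_nat_diff)
qed

lemma diagram_eigenvalue_two_row_inj:
  assumes "2 * a \<le> i" "2 * b \<le> i"
    and "diagram_eigenvalue (two_row i a) = diagram_eigenvalue (two_row i b)"
  shows "a = b"
proof -
  have "(int i - int a)\<^sup>2 + (int a)\<^sup>2 - 2 * int a = (int i - int b)\<^sup>2 + (int b)\<^sup>2 - 2 * int b"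
    using assms by (simp only: diagram_eigenvalue_two_row of_int_eq_iff)
  \<comment> \<open>The quadratic is symmetric about \<open>(i + 1) / 2\<close>, so a difference of
    two values factors; the second factor is positive because \<open>a + b \<le> i\<close>.\<close>
  then have "(int b - int a) * (int i + 1 - int a - int b) = 0"
    by (simp add: algebra_simps power2_eq_square)
  then show ?thesis using assms(1,2) by auto
qed

lemma second_row_card: "card {c. (1, c) \<in> two_row i a} = a"
  by (simp add: two_row_def)

lemma two_row_inj: "two_row i a = two_row i b \<Longrightarrow> a = b"
  by (metis second_row_card)

lemma add_box_two_row:
  assumes D: "D \<in> young_diagrams j" and add: "add_box D (two_row (Suc j) a)" and a: "2 * a \<le> Suc j"
  shows "\<exists>b. 2 * b \<le> j \<and> D = two_row j b \<and> (a = b \<or> a = Suc b)"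
proof -
  obtain x where x: "x \<notin> D" "two_row (Suc j) a = insert x D"
    using add by (auto simp: add_box_def)
  then have D_eq: "D = two_row (Suc j) a - {x}" and "x \<in> two_row (Suc j) a" by auto
  have down: "(r', c') \<in> D" if "(r, c) \<in> D" "r' \<le> r" "c' \<le> c" for r c r' c'
    using D that by (fastforce simp: young_diagrams_def)
  from \<open>x \<in> two_row (Suc j) a\<close> consider c where "x = (0, c)" "c < Suc j - a"
    | c where "x = (1, c)" "c < a"
    by (auto simp: two_row_def)
  then show ?thesis
  proof cases
    case 1
    \<comment> \<open>\<open>D\<close> is closed to the left, so the removed box must be the last
      one in its row.\<close>
    have "c = j - a"
    proof (rule ccontr)
      assume "c \<noteq> j - a"
      then have "(0, j - a) \<in> D" using 1 a by (auto simp: D_eq two_row_def)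
      then show False using down[of 0 "j - a" 0 c] 1 x by auto
    qed
    \<comment> \<open>With rows of equal length the box below the removed one would remain.\<close>
    moreover have "2 * a \<noteq> Suc j"
    proof
      assume "2 * a = Suc j"
      then have "(1, a - 1) \<in> D" "a - 1 = c"
        using 1 \<open>c = j - a\<close> by (auto simp: D_eq two_row_def)
      then show False using down[of 1 "a - 1" 0 c] 1 x by auto
    qed
    ultimately show ?thesis
      using 1 a by (intro exI[of _ a]) (auto simp: D_eq two_row_def)
  next
    case 2
    have "c = a - 1"
    proof (rule ccontr)
      assume "c \<noteq> a - 1"
      then have "(1, a - 1) \<in> D" using 2 by (auto simp: D_eq two_row_def)
      then show False using down[of 1 "a - 1" 1 c] 2 x by auto
    qed
    then show ?thesis
      using 2 a by (intro exI[of _ "a - 1"]) (auto simp: D_eq two_row_def)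
  qed
qed

lemma add_box_two_rowI:
  assumes "2 * b \<le> j" "2 * a \<le> Suc j" "a = b \<or> a = Suc b"
  shows "add_box (two_row j b) (two_row (Suc j) a)"
  unfolding add_box_def
proof (intro exI conjI)
  let ?x = "if a = b then (0, j - b) else (1, b)"
  show "?x \<notin> two_row j b" by (auto simp: two_row_def)
  show "two_row (Suc j) a = insert ?x (two_row j b)"
    using assms by (auto simp: two_row_def)
qed

text \<open>\<open>basis_index\<close> prescribes only the last diagram, while the comparison of
  eigenvalues takes place at every level of the chain; \<open>young_chain_two_row\<close> bridges
  the two.\<close>

definition two_row_chain :: "(nat \<times> nat) set list \<Rightarrow> bool"
  where "two_row_chain L \<longleftrightarrow>
    young_chain L \<and> (\<forall>j<length L. \<exists>a. 2 * a \<le> Suc j \<and> L ! j = two_row (Suc j) a)"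

text \<open>The number \<open>a\<close> of the last diagram. The value 0 for the empty chain agrees
  with \<open>a + r \<le> i\<close> at \<open>i = 0\<close>.\<close>

definition second_row :: "(nat \<times> nat) set list \<Rightarrow> nat"
  where "second_row L = (if L = [] then 0 else card {c. (1, c) \<in> last L})"

lemma two_row_chain_last:
  assumes "two_row_chain L"
  shows "2 * second_row L \<le> length L \<and> (L \<noteq> [] \<longrightarrow> last L = two_row (length L) (second_row L))"
proof (cases "L = []")
  case False
  then obtain a where "2 * a \<le> length L" "last L = two_row (length L) a"
    using assms by (fastforce simp: two_row_chain_def last_conv_nth dest: spec[of _ "length L - 1"])
  then show ?thesis using False by (simp add: second_row_def second_row_card[unfolded One_nat_def])
qed (simp add: second_row_def)

lemma second_row_snoc [simp]: "second_row (L @ [two_row i a]) = a"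
  by (simp add: second_row_def second_row_card[unfolded One_nat_def])

lemma young_chain_snoc:
  "young_chain (L @ [M]) \<longleftrightarrow> young_chain L \<and> M \<in> young_diagrams (Suc (length L)) \<and>
    (L \<noteq> [] \<longrightarrow> add_box (last L) M)"
proof -
  have "(\<forall>j. Suc j < length (L @ [M]) \<longrightarrow> add_box ((L @ [M]) ! j) ((L @ [M]) ! Suc j)) \<longleftrightarrow>
      (\<forall>j. Suc j < length L \<longrightarrow> add_box (L ! j) (L ! Suc j)) \<and> (L \<noteq> [] \<longrightarrow> add_box (last L) M)"
    by (cases L rule: rev_cases) (auto simp: nth_append less_Suc_eq)
  moreover have "(\<forall>j<length (L @ [M]). (L @ [M]) ! j \<in> young_diagrams (Suc j)) \<longleftrightarrow>
      (\<forall>j<length L. L ! j \<in> young_diagrams (Suc j)) \<and> M \<in> young_diagrams (Suc (length L))"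
    by (auto simp: nth_append less_Suc_eq)
  ultimately show ?thesis unfolding young_chain_def by blast
qed

text \<open>A new box lengthens the second row by 0 or 1; this recursion reduces chains to
  arithmetic with \<open>second_row\<close>.\<close>

lemma two_row_chain_snoc:
  "two_row_chain (L @ [M]) \<longleftrightarrow> two_row_chain L \<and>
    (\<exists>a. M = two_row (Suc (length L)) a \<and> 2 * a \<le> Suc (length L) \<and>
      (a = second_row L \<or> a = Suc (second_row L)))"
  (is "?l \<longleftrightarrow> ?r")
proof
  assume l: ?l
  then have L: "two_row_chain L"
    by (auto simp: two_row_chain_def young_chain_snoc nth_append less_Suc_eq)
  from l obtain a where a: "M = two_row (Suc (length L)) a" "2 * a \<le> Suc (length L)"
    by (force simp: two_row_chain_def nth_append)
  have "a = second_row L \<or> a = Suc (second_row L)"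
  proof (cases "L = []")
    case False
    have "add_box (last L) M" "last L \<in> young_diagrams (length L)"
      using l L False
      by (auto simp: two_row_chain_def young_chain_snoc)
        (auto simp: young_chain_def last_conv_nth dest!: spec[of _ "length L - 1"])
    then obtain b where "last L = two_row (length L) b" "a = b \<or> a = Suc b"
      using add_box_two_row a by blast
    moreover have "b = second_row L"
      using two_row_chain_last[OF L] False calculation(1) two_row_inj by metis
    ultimately show ?thesis by simp
  qed (use a in \<open>auto simp: second_row_def\<close>)
  with L a show ?r by blast
next
  assume ?r
  then obtain a where L: "two_row_chain L" and a: "M = two_row (Suc (length L)) a"
    "2 * a \<le> Suc (length L)" "a = second_row L \<or> a = Suc (second_row L)" by blast
  have "L \<noteq> [] \<longrightarrow> add_box (last L) M"
    using two_row_chain_last[OF L] a by (auto intro: add_box_two_rowI)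
  then show ?l
    using L a by (auto simp: two_row_chain_def young_chain_snoc nth_append less_Suc_eq
        two_row_young_diagram)
qed

text \<open>Descent from the last diagram: removing a box from a two-row diagram leaves one.\<close>

lemma young_chain_two_row:
  assumes "young_chain L" "L \<noteq> [] \<Longrightarrow> last L = two_row (length L) a" "2 * a \<le> length L"
  shows "two_row_chain L"
  using assms
proof (induction L arbitrary: a rule: rev_induct)
  case (snoc M L)
  have M: "M = two_row (Suc (length L)) a" and chain: "young_chain L"
    and add: "L \<noteq> [] \<longrightarrow> add_box (last L) M"
    using snoc.prems by (auto simp: young_chain_snoc)
  have "\<exists>b. 2 * b \<le> length L \<and> (L \<noteq> [] \<longrightarrow> last L = two_row (length L) b)"
  proof (cases "L = []")
    case False
    then have "last L \<in> young_diagrams (length L)"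
      using chain by (auto simp: young_chain_def last_conv_nth dest!: spec[of _ "length L - 1"])
    then show ?thesis using add_box_two_row[of "last L" "length L" a] add False snoc.prems(3)
      by (auto simp: M)
  qed auto
  then have "two_row_chain L" using snoc.IH chain by blast
  then show ?case
    using snoc.prems M
    by (auto simp: two_row_chain_def nth_append less_Suc_eq)
qed (simp add: two_row_chain_def young_chain_def)

text \<open>The label determines both witnesses: \<open>r\<close> is
  \<open>k - count_list c 1\<close>, the number of letters 1 before the suffix, and \<open>a\<close>
  is \<open>second_row L\<close>.\<close>

lemma basis_index_iff:
  "(L, c) \<in> basis_index n k i \<longleftrightarrow> two_row_chain L \<and> length L = i \<and> length c = n - i \<and>
    set c \<subseteq> {1, 2} \<and> count_list c 1 \<le> k \<and> second_row L \<le> k - count_list c 1 \<and>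
    second_row L + (k - count_list c 1) \<le> i"
  (is "_ \<longleftrightarrow> ?r")
proof
  assume "(L, c) \<in> basis_index n k i"
  then obtain r a where *: "young_chain L" "length L = i" "length c = n - i" "set c \<subseteq> {1, 2}"
    "r \<le> k" "count_list c 1 = k - r" "a \<le> r" "a + r \<le> i" "i > 0 \<longrightarrow> last L = two_row i a"
    by (auto simp: basis_index_def)
  have "two_row_chain L" by (rule young_chain_two_row[of L a]) (use * in auto)
  moreover have "second_row L = a"
  proof (cases "L = []")
    case True
    then show ?thesis using * by (simp add: second_row_def)
  next
    case False
    then show ?thesis
      using * by (auto simp: second_row_def second_row_card[unfolded One_nat_def])
  qed
  ultimately show ?r using * by simp
next
  assume r: ?r
  then have "count_list c 1 = k - (k - count_list c 1)" by simp
  with r show "(L, c) \<in> basis_index n k i"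
    using two_row_chain_last[of L]
    unfolding basis_index_def mem_Collect_eq case_prod_conv
    by (intro conjI exI[of _ "k - count_list c 1"] exI[of _ "second_row L"])
      (auto simp: two_row_chain_def)
qed

section \<open>Orthonormal families\<close>

definition orthonormal_family ::
    "nat \<Rightarrow> nat \<Rightarrow> ('i \<Rightarrow> nat list \<Rightarrow> complex) \<Rightarrow> 'i set \<Rightarrow> bool"
  where "orthonormal_family n k v I \<longleftrightarrow> v ` I \<subseteq> wfuns n k \<and>
    (\<forall>b\<in>I. \<forall>b'\<in>I. winner n k (v b) (v b') = (if b = b' then 1 else 0))"

lemma wfuns_eq_span: "wfuns n k = cfun.span (delta ` words n k)"
proof
  show "cfun.span (delta ` words n k) \<subseteq> wfuns n k"
    by (rule cfun.span_minimal[OF _ subspace_wfuns]) (auto simp: wfuns_def delta_def)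
  show "wfuns n k \<subseteq> cfun.span (delta ` words n k)"
  proof
    fix f assume "f \<in> wfuns n k"
    then have "f = (\<Sum>w\<in>words n k. fscale (f w) (delta w))"
      by (auto simp: fun_eq_iff sum_fun_apply fscale_def delta_def wfuns_def if_distrib
          cong: if_cong)
    also have "\<dots> \<in> cfun.span (delta ` words n k)"
      by (intro cfun.span_sum cfun.span_scale cfun.span_base) auto
    finally show "f \<in> cfun.span (delta ` words n k)" .
  qed
qed

context
  fixes n k :: nat and v :: "'i \<Rightarrow> nat list \<Rightarrow> complex" and I :: "'i set"
  assumes on: "orthonormal_family n k v I"
begin

lemma orthonormal_family_inj: "inj_on v I"
  using on by (auto simp: orthonormal_family_def inj_on_def) (metis zero_neq_one)

lemma orthonormal_family_independent: "cfun.independent (v ` I)"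
  unfolding cfun.dependent_def
proof
  assume "\<exists>x\<in>v ` I. x \<in> cfun.span (v ` I - {x})"
  then obtain b where b: "b \<in> I" "v b \<in> cfun.span (v ` I - {v b})" by blast
  have "cfun.span (v ` I - {v b}) \<subseteq> {f. winner n k f (v b) = 0}"
  proof (rule cfun.span_minimal)
    show "v ` I - {v b} \<subseteq> {f. winner n k f (v b) = 0}"
      using on b(1) by (auto simp: orthonormal_family_def)
    show "cfun.subspace {f. winner n k f (v b) = 0}"
      by (simp add: cfun.subspace_def winner_linear)
  qed
  then show False using b on by (auto simp: orthonormal_family_def)
qed

lemma orthonormal_family_card_le: "finite I \<and> card I \<le> n choose k"
proof -
  have "finite (v ` I) \<and> card (v ` I) \<le> card (delta ` words n k)"
    using on orthonormal_family_independent
    by (intro cfun.independent_span_bound) (auto simp: orthonormal_family_def wfuns_eq_span)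
  moreover have "card (delta ` words n k) \<le> n choose k"
    using card_image_le[of "words n k" delta] by (simp add: card_words)
  ultimately show ?thesis
    using orthonormal_family_inj by (auto simp: card_image dest: finite_imageD)
qed

text \<open>A function outside the span could be added to the family, giving an independent set
  larger than the number of delta functions.\<close>

lemma orthonormal_family_span:
  assumes "card I = n choose k"
  shows "wfuns n k \<subseteq> cfun.span (v ` I)"
proof (rule ccontr)
  assume "\<not> ?thesis"
  then obtain f where f: "f \<in> wfuns n k" "f \<notin> cfun.span (v ` I)" by blast
  have "card (insert f (v ` I)) \<le> card (delta ` words n k)"
    using on orthonormal_family_independent f cfun.independent_insertI[OF f(2)]
    by (intro conjunct2[OF cfun.independent_span_bound])
      (auto simp: orthonormal_family_def wfuns_eq_span)
  also have "\<dots> \<le> n choose k"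
    using card_image_le[of "words n k" delta] by (simp add: card_words)
  finally have "card (insert f (v ` I)) \<le> card I" using assms by simp
  moreover have "f \<notin> v ` I" using f(2) cfun.span_base by blast
  ultimately show False
    using orthonormal_family_inj orthonormal_family_card_le by (simp add: card_image)
qed

lemma orthonormal_family_expansion:
  assumes "card I = n choose k" "f \<in> wfuns n k"
  shows "f = (\<Sum>b\<in>I. fscale (coord v I f b) (v b))"
    and "b \<in> I \<Longrightarrow> coord v I f b = winner n k f (v b)"
proof -
  have fin: "finite I" using orthonormal_family_card_le by blast
  have "(\<Sum>b\<in>v ` I. fscale (cfun.representation (v ` I) f b) b) = f"
    using orthonormal_family_span[OF assms(1)] assms(2) fin
    by (intro cfun.sum_representation_eq orthonormal_family_independent) auto
  then show f: "f = (\<Sum>b\<in>I. fscale (coord v I f b) (v b))"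
    by (simp add: sum.reindex[OF orthonormal_family_inj] coord_def)
  show "coord v I f b = winner n k f (v b)" if "b \<in> I"
  proof -
    have "winner n k f (v b) = (\<Sum>b'\<in>I. if b' = b then coord v I f b' else 0)"
      using on that by (subst f) (auto simp: winner_linear orthonormal_family_def intro!: sum.cong)
    then show ?thesis using fin that by simp
  qed
qed

end

section \<open>Intermediate bases\<close>

lemma suffix_spaceD:
  assumes "f \<in> suffix_space n k c" "f w \<noteq> 0"
  shows "w \<in> words n k \<and> suffix c w"
proof -
  have "suffix_space n k c \<subseteq> {f. \<forall>w. \<not> (w \<in> words n k \<and> suffix c w) \<longrightarrow> f w = 0}"
    unfolding suffix_space_def
    by (rule cfun.span_minimal) (auto simp: cfun.subspace_def fscale_def delta_def)
  with assms show ?thesis by blast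
qed

section \<open>Labels of consecutive levels: counting and sparsity pattern\<close>

lemma basis_index_0: "basis_index n k 0 = Pair [] ` words n k"
  by (auto simp: basis_index_iff words_def second_row_def two_row_chain_def young_chain_def)

text \<open>
  A label of \<open>B\<^sub>i\<close> and its image share the chain of length \<open>i\<close> and the last \<open>n - i - 1\<close> letters.
  For fixed such data there are at most two labels on either side, and the box is added so that
  these are matched: in the second row exactly when the letter lost is 1 and this is possible.
\<close>

definition extend_index :: "nat \<Rightarrow> index \<Rightarrow> index"
  where "extend_index k = (\<lambda>(L, w).
    (L @ [two_row (Suc (length L)) (if hd w = 2 \<or> second_row L + (k - count_list (tl w) 1) > length L
      then second_row L else Suc (second_row L))], tl w))"

lemma extend_index:
  assumes "i < n"
  shows "extend_index k ` basis_index n k i \<subseteq> basis_index n k (Suc i)"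
    and "inj_on (extend_index k) (basis_index n k i)"
proof -
  have w: "\<exists>x c. w = x # c \<and> (x = 1 \<or> x = 2)" if "(L, w) \<in> basis_index n k i" for L w
    using that assms by (cases w) (auto simp: basis_index_iff)
  show "extend_index k ` basis_index n k i \<subseteq> basis_index n k (Suc i)"
  proof
    fix b assume "b \<in> extend_index k ` basis_index n k i"
    then obtain L w where Lw: "(L, w) \<in> basis_index n k i" "b = extend_index k (L, w)" by auto
    then obtain x c where "w = x # c" "x = 1 \<or> x = 2" using w by blast
    with Lw two_row_chain_last[of L] show "b \<in> basis_index n k (Suc i)"
      by (auto simp: extend_index_def basis_index_iff two_row_chain_snoc)
  qed
  show "inj_on (extend_index k) (basis_index n k i)"
  proof (rule inj_onI)
    fix b b' assume bb: "b \<in> basis_index n k i" "b' \<in> basis_index n k i"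
      "extend_index k b = extend_index k b'"
    obtain L x c where b: "b = (L, x # c)" "x = 1 \<or> x = 2"
      using w bb(1) by (metis surj_pair)
    obtain L' x' c' where b': "b' = (L', x' # c')" "x' = 1 \<or> x' = 2"
      using w bb(2) by (metis surj_pair)
    have eq: "L = L'" "c = c'" using bb(3) b b' by (auto simp: extend_index_def)
    have row: "(if x = 2 \<or> second_row L + (k - count_list c 1) > length L
        then second_row L else Suc (second_row L)) =
      (if x' = 2 \<or> second_row L + (k - count_list c 1) > length L
        then second_row L else Suc (second_row L))"
      using bb(3) unfolding b b' eq extend_index_def by (auto dest!: two_row_inj split: if_splits)
    \<comment> \<open>If the letter 2 yields a label, this bound rules out the exceptional case for
      the letter 1, so the two letters lead to different second rows.\<close>
    have "second_row L + (k - count_list c 1) \<le> length L" if "x = 2 \<or> x' = 2"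
      using that bb(1,2) b b' eq by (auto simp: basis_index_iff)
    then have "x = x'" using row b(2) b'(2) by (cases "x = 2"; cases "x' = 2") auto
    with eq show "b = b'" using b b' by simp
  qed
qed

text \<open>Meant for labels of consecutive levels, the lower one first. As it looks at labels only,
  the pattern is the same for all choices of bases.\<close>

definition linked :: "index \<Rightarrow> index \<Rightarrow> bool"
  where "linked d c \<longleftrightarrow> fst d = butlast (fst c) \<and> snd c = tl (snd d)"

text \<open>Only the lost letter is free, and it is 1 or 2.\<close>

lemma card_linked_pred:
  assumes "i < n"
  shows "finite {d \<in> basis_index n k i. linked d c} \<and> card {d \<in> basis_index n k i. linked d c} \<le> 2"
proof -
  let ?T = "{(butlast (fst c), 1 # snd c), (butlast (fst c), 2 # snd c)}"
  have sub: "{d \<in> basis_index n k i. linked d c} \<subseteq> ?T"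
  proof
    fix d assume "d \<in> {d \<in> basis_index n k i. linked d c}"
    then show "d \<in> ?T"
      using assms by (cases d; cases "snd d") (auto simp: linked_def basis_index_iff)
  qed
  moreover have "card ?T \<le> 2" by (simp add: card_insert_if)
  ultimately show ?thesis
    using card_mono[OF _ sub] by (auto intro: finite_subset)
qed

text \<open>Only the row of the added box is free.\<close>

lemma card_linked_succ:
  "finite {c \<in> basis_index n k (Suc i). linked d c} \<and>
    card {c \<in> basis_index n k (Suc i). linked d c} \<le> 2"
proof -
  let ?f = "\<lambda>a. (fst d @ [two_row (Suc i) a], tl (snd d))"
  let ?T = "?f ` {second_row (fst d), Suc (second_row (fst d))}"
  have sub: "{c \<in> basis_index n k (Suc i). linked d c} \<subseteq> ?T"
  proof
    fix c assume "c \<in> {c \<in> basis_index n k (Suc i). linked d c}"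
    then obtain M u where c: "c = (M, u)" "two_row_chain M" "length M = Suc i" "linked d (M, u)"
      by (cases c) (auto simp: basis_index_iff)
    obtain L X where "M = L @ [X]" using c(3) by (cases M rule: rev_cases) auto
    then show "c \<in> ?T" using c by (auto simp: linked_def two_row_chain_snoc)
  qed
  moreover have "card ?T \<le> 2" by (rule order.trans[OF card_image_le]) (auto simp: card_insert_if)
  ultimately show ?thesis
    using card_mono[OF _ sub] by (auto intro: finite_subset)
qed

section \<open>Orthonormality, completeness and change of basis for a given family\<close>

locale intermediate =
  fixes n k :: nat and B :: "nat \<Rightarrow> index \<Rightarrow> nat list \<Rightarrow> complex"
  assumes bases: "intermediate_bases n k B"
begin

lemma basis_vector:
  assumes "i \<le> n" "(L, c) \<in> basis_index n k i"
  shows "j < i \<Longrightarrow> B i (L, c) \<in> isotypic n k (Suc j) (L ! j)"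
    and "B i (L, c) w \<noteq> 0 \<Longrightarrow> w \<in> words n k \<and> suffix c w"
    and "winner n k (B i (L, c)) (B i (L, c)) = 1"
    and "cnj (B i (L, c) w) = B i (L, c) w"
proof -
  have *: "B i (L, c) \<in> joint_space n k (L, c)" "winner n k (B i (L, c)) (B i (L, c)) = 1"
    "B i (L, c) w \<in> \<real>"
    using bases assms by (auto simp: intermediate_bases_def)
  show "B i (L, c) \<in> isotypic n k (Suc j) (L ! j)" if "j < i"
    using * assms that by (auto simp: joint_space_def basis_index_iff)
  show "w \<in> words n k \<and> suffix c w" if "B i (L, c) w \<noteq> 0"
    using * that by (intro suffix_spaceD) (auto simp: joint_space_def)
  show "winner n k (B i (L, c)) (B i (L, c)) = 1" "cnj (B i (L, c) w) = B i (L, c) w"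
    using * by (auto simp: Reals_cnj_iff)
qed

text \<open>Real values turn conjugate symmetry into symmetry, so the matrix of the way down is the
  transpose of the given one.\<close>

lemma winner_basis_cnj:
  assumes "i \<le> n" "b \<in> basis_index n k i" "j \<le> n" "c \<in> basis_index n k j"
  shows "winner n k (B j c) (B i b) = winner n k (B i b) (B j c)"
  using assms basis_vector(4) by (cases b; cases c) (simp add: winner_def mult.commute)

text \<open>A common point of the supports makes the suffixes compatible; chains differing at an
  index \<open>m < i\<close> would put the vectors into orthogonal isotypic components for
  \<open>Suc m\<close> points. The case \<open>j = i\<close> gives orthonormality,
  \<open>j = Suc i\<close> sparsity.\<close>

lemma winner_basis_nonzero:
  assumes "i \<le> j" "j \<le> n" and b: "(L, c) \<in> basis_index n k i" and b': "(L', c') \<in> basis_index n k j"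
    and nz: "winner n k (B i (L, c)) (B j (L', c')) \<noteq> 0"
  shows "L = take i L' \<and> c' = drop (j - i) c"
proof
  have i: "i \<le> n" using assms by simp
  have "\<exists>w\<in>words n k. B i (L, c) w \<noteq> 0 \<and> B j (L', c') w \<noteq> 0"
  proof (rule ccontr)
    assume "\<not> ?thesis"
    then have "winner n k (B i (L, c)) (B j (L', c')) = 0"
      unfolding winner_def by (intro sum.neutral) auto
    with nz show False by simp
  qed
  then obtain w where "suffix c w" "suffix c' w"
    using basis_vector(2)[OF i b] basis_vector(2)[OF \<open>j \<le> n\<close> b'] by blast
  moreover have len: "length c = n - i" "length c' = n - j"
    using b b' by (auto simp: basis_index_iff)
  ultimately have "suffix c' c" using \<open>i \<le> j\<close> by (auto intro: suffix_length_suffix)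
  then show "c' = drop (j - i) c"
    using len assms(1,2) by (auto simp: suffix_def)
  have "L ! m = L' ! m" if m: "m < i" for m
  proof (rule ccontr)
    assume ne: "L ! m \<noteq> L' ! m"
    obtain a a' where a: "2 * a \<le> Suc m" "L ! m = two_row (Suc m) a"
      "2 * a' \<le> Suc m" "L' ! m = two_row (Suc m) a'"
      using b b' m \<open>i \<le> j\<close> by (auto simp: basis_index_iff two_row_chain_def dest!: spec[of _ m])
    then have "diagram_eigenvalue (L ! m) \<noteq> diagram_eigenvalue (L' ! m)"
      using ne diagram_eigenvalue_two_row_inj by metis
    then have "winner n k (B i (L, c)) (B j (L', c')) = 0"
      using basis_vector(1)[OF i b m] basis_vector(1)[OF \<open>j \<le> n\<close> b', of m] m assms(1,2) a
      by (intro isotypic_orthogonal[of "Suc m" n "L ! m" "L' ! m"])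
        (auto intro: two_row_young_diagram)
    with nz show False by simp
  qed
  then show "L = take i L'"
    using b b' \<open>i \<le> j\<close> by (intro nth_equalityI) (auto simp: basis_index_iff)
qed

lemma winner_basis_unlinked:
  assumes "i < n" "d \<in> basis_index n k i" "c \<in> basis_index n k (Suc i)" "\<not> linked d c"
  shows "winner n k (B i d) (B (Suc i) c) = 0"
proof (rule ccontr)
  assume "winner n k (B i d) (B (Suc i) c) \<noteq> 0"
  then have "fst d = take i (fst c) \<and> snd c = drop (Suc i - i) (snd d)"
    using winner_basis_nonzero[of i "Suc i" "fst d" "snd d" "fst c" "snd c"] assms by simp
  moreover have "length (fst c) = Suc i"
    using assms(3) by (cases c) (simp add: basis_index_iff)
  ultimately show False
    using assms(4) by (simp add: linked_def butlast_conv_take drop_Suc)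
qed

lemma orthonormal_basis:
  assumes "i \<le> n"
  shows "orthonormal_family n k (B i) (basis_index n k i)"
proof -
  have "winner n k (B i b) (B i b') = 0"
    if "b \<in> basis_index n k i" "b' \<in> basis_index n k i" "b \<noteq> b'" for b b'
  proof (rule ccontr)
    assume "winner n k (B i b) (B i b') \<noteq> 0"
    then have "fst b = take i (fst b') \<and> snd b' = snd b"
      using winner_basis_nonzero[of i i "fst b" "snd b" "fst b'" "snd b'"] that(1,2) assms by simp
    moreover have "length (fst b') = i" using that(2) by (cases b') (simp add: basis_index_iff)
    ultimately show False using that(3) by (simp add: prod_eq_iff)
  qed
  moreover have "B i b \<in> wfuns n k" if "b \<in> basis_index n k i" for b
    using basis_vector(2)[OF assms, of "fst b" "snd b"] that by (auto simp: wfuns_def)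
  moreover have "winner n k (B i b) (B i b) = 1" if "b \<in> basis_index n k i" for b
    using basis_vector(3)[OF assms, of "fst b" "snd b"] that by simp
  ultimately show ?thesis by (auto simp: orthonormal_family_def)
qed

text \<open>At level 0 the labels are the words; \<open>extend_index\<close> keeps their number from
  falling, and orthonormality keeps it within the dimension.\<close>

lemma card_basis_index:
  assumes "i \<le> n"
  shows "card (basis_index n k i) = n choose k"
  using assms
proof (induction i)
  case 0
  show ?case by (simp add: basis_index_0 card_image card_words inj_on_def)
next
  case (Suc i)
  note le = orthonormal_family_card_le[OF orthonormal_basis[OF Suc.prems]]
  have "card (basis_index n k i) \<le> card (basis_index n k (Suc i))"
    using extend_index[of i n k] Suc.prems le by (intro card_inj_on_le) auto
  then show ?case using Suc le by simp
qed

lemma coord_basis: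
  assumes "i \<le> n" "f \<in> wfuns n k" "b \<in> basis_index n k i"
  shows "coord (B i) (basis_index n k i) f b = winner n k f (B i b)"
  using orthonormal_family_expansion(2)[OF orthonormal_basis[OF assms(1)] card_basis_index] assms
  by blast

lemma finite_basis_index: "i \<le> n \<Longrightarrow> finite (basis_index n k i)"
  using orthonormal_family_card_le[OF orthonormal_basis] by blast

lemma basis_wfuns: "i \<le> n \<Longrightarrow> b \<in> basis_index n k i \<Longrightarrow> B i b \<in> wfuns n k"
  using orthonormal_basis[of i] by (auto simp: orthonormal_family_def)

lemma basis_expansion:
  assumes "i \<le> n" "f \<in> wfuns n k"
  shows "f = (\<Sum>b\<in>basis_index n k i. fscale (winner n k f (B i b)) (B i b))"
  using orthonormal_family_expansion(1)[OF orthonormal_basis[OF assms(1)] card_basis_index[OF assms(1)]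
      assms(2)] coord_basis[OF assms]
  by simp

text \<open>Parseval's identity, cut down to the labels \<open>S\<close> that can contribute;
  \<open>g\<close> is a vector of a neighbouring basis in both uses.\<close>

lemma change_of_basis:
  assumes "i \<le> n" "f \<in> wfuns n k" "S \<subseteq> basis_index n k i"
    and "\<And>d. d \<in> basis_index n k i \<Longrightarrow> d \<notin> S \<Longrightarrow> winner n k (B i d) g = 0"
  shows "winner n k f g = (\<Sum>d\<in>S. winner n k (B i d) g * winner n k f (B i d))"
proof -
  have "winner n k f g =
      (\<Sum>d\<in>basis_index n k i. winner n k (B i d) g * winner n k f (B i d))"
    by (subst basis_expansion[OF assms(1,2)]) (simp add: winner_linear mult.commute)
  also have "\<dots> = (\<Sum>d\<in>S. winner n k (B i d) g * winner n k f (B i d))"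
    using assms(3,4) finite_basis_index[OF assms(1)] by (intro sum.mono_neutral_right) auto
  finally show ?thesis .
qed

lemma forward_step:
  assumes "i < n" "f \<in> wfuns n k" "c \<in> basis_index n k (Suc i)"
  shows "winner n k f (B (Suc i) c) = (\<Sum>d\<in>{d \<in> basis_index n k i. linked d c}.
    coord (B (Suc i)) (basis_index n k (Suc i)) (B i d) c * winner n k f (B i d))"
proof -
  have "winner n k f (B (Suc i) c) = (\<Sum>d\<in>{d \<in> basis_index n k i. linked d c}.
      winner n k (B i d) (B (Suc i) c) * winner n k f (B i d))"
    using assms winner_basis_unlinked by (intro change_of_basis) auto
  then show ?thesis using assms by (simp add: coord_basis basis_wfuns)
qed

text \<open>The entries are those of the forward step, now summed over the row index
  \<open>c\<close>.\<close>

lemma backward_step: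
  assumes "i < n" "f \<in> wfuns n k" "d \<in> basis_index n k i"
  shows "winner n k f (B i d) = (\<Sum>c\<in>{c \<in> basis_index n k (Suc i). linked d c}.
    coord (B (Suc i)) (basis_index n k (Suc i)) (B i d) c * winner n k f (B (Suc i) c))"
proof -
  have sym: "winner n k (B (Suc i) c) (B i d) = winner n k (B i d) (B (Suc i) c)"
    if "c \<in> basis_index n k (Suc i)" for c
    using assms that by (intro winner_basis_cnj) auto
  have "winner n k f (B i d) = (\<Sum>c\<in>{c \<in> basis_index n k (Suc i). linked d c}.
      winner n k (B (Suc i) c) (B i d) * winner n k f (B (Suc i) c))"
    using assms winner_basis_unlinked sym by (intro change_of_basis) auto
  then show ?thesis using assms by (simp add: coord_basis basis_wfuns sym)
qed

end

section \<open>Projections to isotypic components\<close>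

context intermediate
begin

text \<open>The differences \<open>h a\<close> are pairwise orthogonal and sum to zero, so each has
  norm zero. This is the uniqueness behind the definite description in
  \<open>isotypic_parts\<close>.\<close>

lemma isotypic_parts_unique:
  assumes "\<forall>a\<le>min k (n - k). g a \<in> isotypic n k n (two_row n a)"
    and "\<forall>a\<le>min k (n - k). g' a \<in> isotypic n k n (two_row n a)"
    and "(\<Sum>a\<le>min k (n - k). g a) = (\<Sum>a\<le>min k (n - k). g' a)"
    and b: "b \<le> min k (n - k)"
  shows "g b = g' b"
proof -
  let ?s = "min k (n - k)"
  \<comment> \<open>For \<open>k > n\<close> the truncated \<open>n - k\<close> is 0, which leaves
    only \<open>a = 0\<close>.\<close>
  have two: "2 * a \<le> n" if "a \<le> ?s" for a using that by (cases "k \<le> n") auto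
  define h where "h a = g a - g' a" for a
  have h: "h a \<in> isotypic n k n (two_row n a)" if "a \<le> ?s" for a
    using assms(1,2) that unfolding h_def isotypic_def by (intro cfun.span_diff) auto
  have orth: "winner n k (h a) (h b) = 0" if "a \<le> ?s" "a \<noteq> b" for a
  proof (rule isotypic_orthogonal[OF order_refl _ _ _ h h])
    show "diagram_eigenvalue (two_row n a) \<noteq> diagram_eigenvalue (two_row n b)"
      using that two b diagram_eigenvalue_two_row_inj[of a n b] by blast
  qed (use that b two in \<open>simp_all add: two_row_young_diagram\<close>)
  have "(\<Sum>a\<le>?s. h a) = 0" using assms(3) by (simp add: h_def sum_subtractf)
  then have "0 = (\<Sum>a\<le>?s. winner n k (h a) (h b))"
    by (metis winner_linear(4,5))
  also have "\<dots> = winner n k (h b) (h b)"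
    using b orth by (subst sum.remove[of _ b]) auto
  finally have "h b = 0"
    using subsetD[OF isotypic_subset_wfuns h[OF b]] by (intro winner_eq_0_imp[of _ n k]) auto
  then show ?thesis by (simp add: h_def)
qed

text \<open>At level \<open>n\<close> the suffix is empty, so \<open>r = k\<close> in the bounds on
  \<open>a\<close>.\<close>

lemma second_row_le:
  assumes "b \<in> basis_index n k n"
  shows "second_row (fst b) \<le> min k (n - k)"
  using assms by (cases b) (auto simp: basis_index_iff)

text \<open>A vector of \<open>B n\<close> lies in the component of the last diagram of its chain,
  so grouping the expansion of \<open>f\<close> by second rows is a decomposition, and uniqueness
  identifies it.\<close>

lemma isotypic_parts_eq:
  assumes "n \<ge> 1" and f: "f \<in> wfuns n k"
  shows "isotypic_parts n k f a =
    (\<Sum>b\<in>{b \<in> basis_index n k n. second_row (fst b) = a}. fscale (winner n k f (B n b)) (B n b))"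
proof -
  let ?s = "min k (n - k)"
  define g where "g a = (\<Sum>b\<in>{b \<in> basis_index n k n. second_row (fst b) = a}.
    fscale (winner n k f (B n b)) (B n b))" for a
  have iso: "g a \<in> isotypic n k n (two_row n a)" for a
  proof -
    have "B n (L, c) \<in> isotypic n k n (two_row n (second_row L))" if "(L, c) \<in> basis_index n k n" for L c
    proof -
      have "L ! (n - 1) = two_row n (second_row L)"
        using that two_row_chain_last[of L] assms(1) by (auto simp: basis_index_iff last_conv_nth)
      then show ?thesis using basis_vector(1)[OF order_refl that, of "n - 1"] assms(1) by simp
    qed
    then show ?thesis
      unfolding g_def isotypic_def by (intro cfun.span_sum cfun.span_scale) auto
  qed
  have zero: "g a = 0" if "a > ?s" for a
    using second_row_le that unfolding g_def by (intro sum.neutral) force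
  have "(\<Sum>a\<le>?s. g a) = (\<Sum>b\<in>basis_index n k n. fscale (winner n k f (B n b)) (B n b))"
    unfolding g_def using second_row_le finite_basis_index[OF order_refl]
    by (intro sum.group) auto
  then have sum: "f = (\<Sum>a\<le>?s. g a)" using basis_expansion[OF order_refl f] by simp
  have "isotypic_parts n k f = g"
    unfolding isotypic_parts_def
  proof (rule the_equality)
    show "(\<forall>a\<le>?s. g a \<in> isotypic n k n (two_row n a)) \<and> (\<forall>a>?s. g a = 0) \<and> f = sum g {..?s}"
      using iso zero sum by blast
    fix g' assume g': "(\<forall>a\<le>?s. g' a \<in> isotypic n k n (two_row n a)) \<and> (\<forall>a>?s. g' a = 0) \<and>
      f = sum g' {..?s}"
    show "g' = g"
    proof
      fix a
      show "g' a = g a"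
        using g' iso zero sum isotypic_parts_unique[of g' g a] by (cases "a \<le> ?s") auto
    qed
  qed
  then show ?thesis by (simp add: g_def)
qed

lemma isotypic_sum_wfuns: "n \<ge> 1 \<Longrightarrow> f \<in> wfuns n k \<Longrightarrow> isotypic_sum n k H f \<in> wfuns n k"
  unfolding isotypic_sum_def
  by (auto simp: isotypic_parts_eq basis_wfuns intro!: cfun.subspace_sum cfun.subspace_scale
      subspace_wfuns)

lemma winner_isotypic_sum:
  assumes "n \<ge> 1" "f \<in> wfuns n k" "finite H" and b: "b \<in> basis_index n k n"
  shows "winner n k (isotypic_sum n k H f) (B n b) =
    (if second_row (fst b) \<in> H then winner n k f (B n b) else 0)"
proof -
  have "winner n k (isotypic_parts n k f a) (B n b) =
      (if second_row (fst b) = a then winner n k f (B n b) else 0)" for a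
  proof -
    let ?S = "{b \<in> basis_index n k n. second_row (fst b) = a}"
    have "winner n k (isotypic_parts n k f a) (B n b) =
        (\<Sum>b'\<in>?S. if b' = b then winner n k f (B n b') else 0)"
      using orthonormal_basis[OF order_refl] b assms
      by (auto simp: isotypic_parts_eq winner_linear orthonormal_family_def intro!: sum.cong)
    then show ?thesis using b finite_basis_index[OF order_refl] by simp
  qed
  then show ?thesis using assms(3) by (simp add: isotypic_sum_def winner_linear)
qed

text \<open>The normalization equates \<open>B 1\<close> and \<open>B 0\<close> only as sets. To
  match labels, the support of the delta function fixes its last \<open>n - 1\<close> letters, and
  the number of letters 1 fixes the first.\<close>

lemma first_basis:
  assumes "n \<ge> 1" and w: "x # c \<in> words n k"
  shows "([two_row 1 0], c) \<in> basis_index n k 1" and "B 1 ([two_row 1 0], c) = B 0 ([], x # c)"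
proof -
  have "two_row_chain [two_row 1 0]"
    using two_row_chain_snoc[of "[]" "two_row 1 0"]
    by (auto simp: two_row_chain_def young_chain_def second_row_def)
  then show idx: "([two_row 1 0], c) \<in> basis_index n k 1"
    using w second_row_snoc[of "[]" 1 0] by (auto simp: basis_index_iff words_def split: if_splits)
  then have "B 1 ([two_row 1 0], c) \<in> B 0 ` basis_index n k 0"
    using bases unfolding intermediate_bases_def by blast
  then obtain w' where w': "w' \<in> words n k" "B 1 ([two_row 1 0], c) = B 0 ([], w')"
    by (auto simp: basis_index_0)
  then have B1: "B 1 ([two_row 1 0], c) = delta w'"
    using bases by (simp add: intermediate_bases_def)
  then have "suffix c w'"
    using basis_vector(2)[OF assms(1) idx, of w'] by (simp add: delta_def)
  then obtain u where u: "w' = u @ c" by (auto simp: suffix_def)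
  then obtain y where "u = [y]"
    using w w'(1) by (cases u; cases "tl u") (auto simp: words_def)
  then have "w' = x # c" using u w w'(1) by (auto simp: words_def split: if_splits)
  then show "B 1 ([two_row 1 0], c) = B 0 ([], x # c)" using w'(2) by simp
qed

lemma basis_index_1:
  assumes "n \<ge> 1" "b \<in> basis_index n k 1"
  shows "\<exists>x c. x # c \<in> words n k \<and> b = ([two_row 1 0], c) \<and> x = (if count_list c 1 = k then 2 else 1)"
proof -
  obtain M c where b: "b = ([] @ [M], c)" "two_row_chain ([] @ [M])" "length c = n - 1"
      "set c \<subseteq> {1, 2}" "count_list c 1 \<le> k" "k - count_list c 1 \<le> 1"
    using assms(2) by (cases b) (auto simp: basis_index_iff length_Suc_conv)
  then have "M = two_row 1 0" by (subst (asm) two_row_chain_snoc) (auto simp: second_row_def)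
  then show ?thesis using b assms(1) by (auto simp: words_def)
qed

end

section \<open>Computing the projections\<close>

definition data_of ::
    "nat \<Rightarrow> nat \<Rightarrow> (nat \<Rightarrow> index \<Rightarrow> nat list \<Rightarrow> complex) \<times> (nat list \<Rightarrow> complex) \<Rightarrow> input \<Rightarrow> complex"
  where "data_of n k = (\<lambda>(B, f). input_val n k B f)"

definition data :: "nat \<Rightarrow> nat \<Rightarrow> ((nat \<Rightarrow> index \<Rightarrow> nat list \<Rightarrow> complex) \<times> (nat list \<Rightarrow> complex)) set"
  where "data n k = {B. intermediate_bases n k B} \<times> wfuns n k"

context
  fixes n k :: nat
  assumes n: "n \<ge> 1" and ex: "\<exists>B. intermediate_bases n k B"
begin

text \<open>The label sets do not depend on the bases, but their size is known through one family,
  here a witness of \<open>ex\<close>.\<close>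

lemma finite_card_index:
  assumes "i \<le> n"
  shows "finite (basis_index n k i)" "card (basis_index n k i) = n choose k"
  using ex assms intermediate.finite_basis_index intermediate.card_basis_index
  by (auto simp: intermediate_def)

lemma computable_forward:
  assumes "1 \<le> i" "i \<le> n"
  shows "computable (inputs n k) (data_of n k) (data n k) (2 * (n choose k) * (i - 1))
    (basis_index n k i) (\<lambda>(B, f) b. winner n k f (B i b))"
  using assms
proof (induction i rule: dec_induct)
  case base
  \<comment> \<open>Restores the lost first letter: it is 2 exactly when the suffix already has
    \<open>k\<close> letters 1. Coordinates in \<open>B 1\<close> are therefore inputs.\<close>
  let ?g = "\<lambda>(L, c). Coord ([], (if count_list c 1 = k then 2 else 1) # c)"
  have "?g b \<in> inputs n k" if "b \<in> basis_index n k 1" for b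
  proof -
    obtain B where "intermediate_bases n k B" using ex by blast
    then interpret intermediate n k B by unfold_locales
    show ?thesis using basis_index_1[OF n that] by (auto simp: inputs_def basis_index_0)
  qed
  moreover have "winner n k f (B 1 b) = data_of n k (B, f) (?g b)"
    if Bf: "(B, f) \<in> data n k" and b: "b \<in> basis_index n k 1" for B f b
  proof -
    interpret intermediate n k B using Bf by unfold_locales (simp add: data_def)
    obtain x c where *: "x # c \<in> words n k" "b = ([two_row 1 0], c)"
        "x = (if count_list c 1 = k then 2 else 1)"
      using basis_index_1[OF n b] by blast
    have "([], x # c) \<in> basis_index n k 0" using * by (simp add: basis_index_0)
    then show ?thesis
      using Bf * first_basis(2)[OF n *(1)] by (simp add: data_of_def data_def coord_basis)
  qed
  ultimately show ?case by (auto intro: computable_inputs[where g = ?g])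
next
  case (step i)
  have "computable (inputs n k) (data_of n k) (data n k)
      (2 * (n choose k) * (i - 1) + 2 * card (basis_index n k (Suc i)))
      (basis_index n k (Suc i)) (\<lambda>(B, f) b. winner n k f (B (Suc i) b))"
  proof (rule computable_sparse_matrix_vector
      [where S = "\<lambda>c. {d \<in> basis_index n k i. linked d c}" and e = "Entry (Suc i)"])
    show "computable (inputs n k) (data_of n k) (data n k) (2 * (n choose k) * (i - 1))
        (basis_index n k i) (\<lambda>(B, f) b. winner n k f (B i b))"
      using step by simp
    show "finite (basis_index n k (Suc i))" using finite_card_index step.prems by simp
    show "finite {d \<in> basis_index n k i. linked d c} \<and>
        card {d \<in> basis_index n k i. linked d c} \<le> 2 \<and>
        {d \<in> basis_index n k i. linked d c} \<subseteq> basis_index n k i" for c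
      using card_linked_pred[of i n k c] step.prems by auto
    show "Entry (Suc i) c d \<in> inputs n k"
      if "c \<in> basis_index n k (Suc i)" "d \<in> {d \<in> basis_index n k i. linked d c}" for c d
      using that step unfolding inputs_def
      by (intro UnI2 CollectI exI[of _ "Suc i"] exI[of _ c] exI[of _ d]) auto
    fix x c assume x: "x \<in> data n k" and c: "c \<in> basis_index n k (Suc i)"
    obtain B f where Bf: "x = (B, f)" by force
    interpret intermediate n k B using x Bf by unfold_locales (simp add: data_def)
    show "(case x of (B, f) \<Rightarrow> \<lambda>b. winner n k f (B (Suc i) b)) c =
      (\<Sum>d\<in>{d \<in> basis_index n k i. linked d c}. data_of n k x (Entry (Suc i) c d) *
        (case x of (B, f) \<Rightarrow> \<lambda>b. winner n k f (B i b)) d)"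
      using forward_step[of i f c] x c step.prems by (simp add: Bf data_def data_of_def)
  qed
  moreover have "2 * (n choose k) * (i - 1) + 2 * (n choose k) = 2 * (n choose k) * (Suc i - 1)"
    using step.hyps by (cases i) auto
  ultimately show ?case using finite_card_index(2)[of "Suc i"] step.prems by simp
qed

lemma computable_backward:
  assumes "i \<le> n" "1 \<le> i" and H: "finite H"
  shows "computable (inputs n k) (data_of n k) (data n k)
    (2 * (n choose k) * (n - 1) + 2 * (n choose k) * (n - i)) (basis_index n k i)
    (\<lambda>(B, f) b. winner n k (isotypic_sum n k H f) (B i b))"
  using assms(1,2)
proof (induction i rule: inc_induct)
  case base
  have "computable (inputs n k) (data_of n k) (data n k) (2 * (n choose k) * (n - 1))
    (basis_index n k n) (\<lambda>(B, f) b. winner n k (isotypic_sum n k H f) (B n b))"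
  proof (rule computable_select[OF computable_forward[OF n order_refl],
        where g = "\<lambda>b. b" and Z = "{b. second_row (fst b) \<notin> H}"])
    fix x b assume x: "x \<in> data n k" and b: "b \<in> basis_index n k n"
    obtain B f where Bf: "x = (B, f)" by force
    interpret intermediate n k B using x Bf by unfold_locales (simp add: data_def)
    show "(case x of (B, f) \<Rightarrow> \<lambda>b. winner n k (isotypic_sum n k H f) (B n b)) b =
      (if b \<in> {b. second_row (fst b) \<notin> H} then 0
       else (case x of (B, f) \<Rightarrow> \<lambda>b. winner n k f (B n b)) b)"
      using winner_isotypic_sum[OF n _ H b] x by (simp add: Bf data_def)
  qed
  then show ?case by simp
next
  case (step i)
  have "computable (inputs n k) (data_of n k) (data n k)
      (2 * (n choose k) * (n - 1) + 2 * (n choose k) * (n - Suc i) + 2 * card (basis_index n k i))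
      (basis_index n k i) (\<lambda>(B, f) b. winner n k (isotypic_sum n k H f) (B i b))"
  proof (rule computable_sparse_matrix_vector
      [where S = "\<lambda>d. {c \<in> basis_index n k (Suc i). linked d c}" and e = "\<lambda>d c. Entry (Suc i) c d"])
    show "computable (inputs n k) (data_of n k) (data n k)
        (2 * (n choose k) * (n - 1) + 2 * (n choose k) * (n - Suc i))
        (basis_index n k (Suc i)) (\<lambda>(B, f) b. winner n k (isotypic_sum n k H f) (B (Suc i) b))"
      using step by simp
    show "finite (basis_index n k i)" using finite_card_index step.hyps by simp
    show "finite {c \<in> basis_index n k (Suc i). linked d c} \<and>
        card {c \<in> basis_index n k (Suc i). linked d c} \<le> 2 \<and>
        {c \<in> basis_index n k (Suc i). linked d c} \<subseteq> basis_index n k (Suc i)" for d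
      using card_linked_succ[of n k i d] by auto
    show "Entry (Suc i) c d \<in> inputs n k"
      if "d \<in> basis_index n k i" "c \<in> {c \<in> basis_index n k (Suc i). linked d c}" for c d
      using that step unfolding inputs_def
      by (intro UnI2 CollectI exI[of _ "Suc i"] exI[of _ c] exI[of _ d]) auto
    fix x d assume x: "x \<in> data n k" and d: "d \<in> basis_index n k i"
    obtain B f where Bf: "x = (B, f)" by force
    interpret intermediate n k B using x Bf by unfold_locales (simp add: data_def)
    show "(case x of (B, f) \<Rightarrow> \<lambda>b. winner n k (isotypic_sum n k H f) (B i b)) d =
      (\<Sum>c\<in>{c \<in> basis_index n k (Suc i). linked d c}. data_of n k x (Entry (Suc i) c d) *
        (case x of (B, f) \<Rightarrow> \<lambda>b. winner n k (isotypic_sum n k H f) (B (Suc i) b)) c)"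
      using backward_step[of i "isotypic_sum n k H f" d] isotypic_sum_wfuns[OF n, of f H]
        x d step.hyps by (simp add: Bf data_def data_of_def)
  qed
  moreover have "n - i = Suc (n - Suc i)" using step.hyps by simp
  ultimately show ?case
    using finite_card_index(2)[of i] step.hyps by (simp add: add.assoc add.left_commute add.commute)
qed

lemma computable_isotypic_sum:
  assumes "finite H"
  shows "computable (inputs n k) (data_of n k) (data n k) (4 * (n - 1) * (n choose k))
    (basis_index n k 0)
    (\<lambda>(B, f) b. coord (B 0) (basis_index n k 0) (isotypic_sum n k H f) b)"
proof -
  have first: "\<exists>x c. b = ([], x # c) \<and> x # c \<in> words n k" if b: "b \<in> basis_index n k 0" for b
  proof -
    obtain w where "b = ([], w)" "w \<in> words n k" using b by (auto simp: basis_index_0)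
    then show ?thesis using n by (cases w) (auto simp: words_def)
  qed
  have "computable (inputs n k) (data_of n k) (data n k)
    (2 * (n choose k) * (n - 1) + 2 * (n choose k) * (n - 1)) (basis_index n k 0)
    (\<lambda>(B, f) b. coord (B 0) (basis_index n k 0) (isotypic_sum n k H f) b)"
  proof (rule computable_select[OF computable_backward[OF n order_refl assms],
        where g = "\<lambda>(L, w). ([two_row 1 0], tl w)" and Z = "{}"])
    show "(case b of (L, w) \<Rightarrow> ([two_row 1 0], tl w)) \<in> basis_index n k 1"
      if "b \<in> basis_index n k 0" for b
    proof -
      obtain B where "intermediate_bases n k B" using ex by blast
      then interpret intermediate n k B by unfold_locales
      show ?thesis using first[OF that] first_basis(1)[OF n] by auto
    qed
    fix p b assume p: "p \<in> data n k" and b: "b \<in> basis_index n k 0"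
    obtain B f where Bf: "p = (B, f)" by force
    interpret intermediate n k B using p Bf by unfold_locales (simp add: data_def)
    obtain x c where xc: "b = ([], x # c)" "x # c \<in> words n k" using first[OF b] by blast
    show "(case p of (B, f) \<Rightarrow> \<lambda>b. coord (B 0) (basis_index n k 0) (isotypic_sum n k H f) b) b =
      (if b \<in> {} then 0 else (case p of (B, f) \<Rightarrow> \<lambda>b. winner n k (isotypic_sum n k H f) (B 1 b))
        (case b of (L, w) \<Rightarrow> ([two_row 1 0], tl w)))"
      using p b xc first_basis(2)[OF n xc(2)] isotypic_sum_wfuns[OF n, of f H]
      by (simp add: Bf data_def coord_basis)
  qed
  moreover have "2 * c * m + 2 * c * m = 4 * m * c" for c m :: nat by simp
  ultimately show ?thesis by (simp only:)
qed

end

theorem theorem8: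
  fixes n k :: nat and H :: "nat set"
  assumes "n \<ge> 1" and "k \<le> n" and "H \<subseteq> {0..min k (n - k)}"
  shows "\<exists>(P :: input program) (out :: index \<Rightarrow> input operand).
    program_ok (inputs n k) P \<and>
    (\<forall>b\<in>basis_index n k 0. operand_ok (inputs n k) (length P) (out b)) \<and>
    length P \<le> 4 * (n - 1) * (n choose k) \<and>
    (\<forall>B. intermediate_bases n k B \<longrightarrow>
      (\<forall>f\<in>wfuns n k. \<forall>b\<in>basis_index n k 0.
        operand_val (input_val n k B f) (run (input_val n k B f) P) (out b) =
        coord (B 0) (basis_index n k 0) (isotypic_sum n k H f) b))"
proof (cases "\<exists>B. intermediate_bases n k B")
  case True
  have "finite H" using assms(3) by (rule finite_subset) simp
  from computable_isotypic_sum[OF assms(1) True this]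
  obtain P out where "program_ok (inputs n k) P"
    "\<forall>b\<in>basis_index n k 0. operand_ok (inputs n k) (length P) (out b)"
    "length P \<le> 4 * (n - 1) * (n choose k)"
    and P: "\<forall>x\<in>data n k. \<forall>b\<in>basis_index n k 0.
      operand_val (data_of n k x) (run (data_of n k x) P) (out b) =
      (case x of (B, f) \<Rightarrow> \<lambda>b. coord (B 0) (basis_index n k 0) (isotypic_sum n k H f) b) b"
    unfolding computable_def by blast
  moreover have "operand_val (input_val n k B f) (run (input_val n k B f) P) (out b) =
        coord (B 0) (basis_index n k 0) (isotypic_sum n k H f) b"
    if "intermediate_bases n k B" "f \<in> wfuns n k" "b \<in> basis_index n k 0" for B f b
    using P[rule_format, of "(B, f)" b] that by (simp add: data_def data_of_def)
  ultimately show ?thesis by blast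
next
  \<comment> \<open>Without any family of bases the condition on \<open>B\<close> is vacuous and the
    empty program suffices.\<close>
  case False
  then show ?thesis
    by (intro exI[of _ "[]"] exI[of _ "\<lambda>_. Zero"]) (simp add: program_ok_def)
qed

end
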